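(* Let $G$ be a finite group and let $p$ be a fixed prime divisor of $|G|$. Suppose that every maximal subgroup of $G$ is nilpotent or has order not divisible by $p$. Then for each prime divisor $q$ of $|G|$, $G$ is $q$-nilpotent or $q$-closed.
   Context: For a prime $q$, a finite group $G$ is $q$-nilpotent if it has a normal $q$-complement (a normal subgroup of order coprime to $q$ and index a power of $q$), and $q$-closed if its Sylow $q$-subgroup is normal in $G$. *)

theory Defs
  imports "HOL-Algebra.Algebra"
begin

definition lower_central_step :: "('a, 'b) monoid_scheme \<Rightarrow> 'a set \<Rightarrow> 'a set" where
  "lower_central_step G H =
     generate G (\<Union>h \<in> H. \<Union>g \<in> carrier G.
        { h \<otimes>\<^bsub>G\<^esub> g \<otimes>\<^bsub>G\<^esub> inv\<^bsub>G\<^esub> h \<otimes>\<^bsub>G\<^esub> inv\<^bsub>G\<^esub> g })"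

definition nilpotent_group :: "('a, 'b) monoid_scheme \<Rightarrow> bool" where
  "nilpotent_group G \<longleftrightarrow> (\<exists>n. (lower_central_step G ^^ n) (carrier G) = {\<one>\<^bsub>G\<^esub>})"

definition maximal_subgroup :: "'a set \<Rightarrow> ('a, 'b) monoid_scheme \<Rightarrow> bool" where
  "maximal_subgroup M G \<longleftrightarrow> subgroup M G \<and> M \<noteq> carrier G \<and>
     (\<forall>H. subgroup H G \<longrightarrow> M \<subseteq> H \<longrightarrow> H = M \<or> H = carrier G)"

definition q_nilpotent :: "('a, 'b) monoid_scheme \<Rightarrow> nat \<Rightarrow> bool" where
  "q_nilpotent G q \<longleftrightarrow> (\<exists>N. N \<lhd> G \<and> coprime (card N) q \<and>
     (\<exists>k. card (rcosets\<^bsub>G\<^esub> N) = q ^ k))"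

definition q_closed :: "('a, 'b) monoid_scheme \<Rightarrow> nat \<Rightarrow> bool" where
  "q_closed G q \<longleftrightarrow> (\<exists>P. subgroup P G \<and> card P = q ^ multiplicity q (order G) \<and> P \<lhd> G)"

end

theory Submission
  imports Defs
begin

text \<open>Call a subgroup of prime power order \<open>p ^ k\<close> a \<open>p\<close>-subgroup. By hypothesis every proper subgroup
  of order divisible by \<open>p\<close> is nilpotent.

  Suppose first that \<open>G\<close> has no nontrivial normal \<open>p\<close>-subgroup. Then normalizers of nontrivial
  \<open>p\<close>-subgroups are nilpotent, which forces distinct Sylow \<open>p\<close>-subgroups to meet trivially. The
  transfer into an abelian \<open>p\<close>-quotient of the normalizer of a Sylow subgroup \<open>P\<close> is therefore
  nontrivial on \<open>P\<close>, and its kernel \<open>K\<close> is a normal \<open>p\<close>-complement. For \<open>q \<noteq> p\<close>, the Frattini argument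
  gives a Sylow \<open>q\<close>-subgroup \<open>Q\<close> normalized by a conjugate \<open>R\<close> of \<open>P\<close>. If \<open>Q R = G\<close> then \<open>Q\<close> is normal;
  otherwise \<open>Q R\<close> is nilpotent and \<open>Q\<close> normalizes \<open>R\<close>. If some Sylow \<open>q\<close>-subgroup were not normal, the
  second case would hold for all \<open>q\<close>, and the order of the normalizer of \<open>P\<close> would be that of \<open>G\<close>.

  In general let \<open>U\<close> be the largest normal \<open>p\<close>-subgroup. If it is nontrivial, all proper subgroups
  of \<open>G/U\<close> are nilpotent, the first case applies to the quotient of \<open>G/U\<close> by its largest normal
  \<open>q\<close>-subgroup, and the conclusion lifts twice along a quotient by a normal subgroup of prime power
  order.\<close>

section \<open>Counting in finite groups\<close>

lemma card_eq_card_image_mult: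
  assumes "finite A" and "\<And>y. y \<in> f ` A \<Longrightarrow> card {x \<in> A. f x = y} = n"
  shows "card A = card (f ` A) * n"
proof -
  have "card A = (\<Sum>x\<in>A. 1)" by simp
  also have "\<dots> = (\<Sum>y\<in>f ` A. \<Sum>x\<in>{x. x \<in> A \<and> f x = y}. 1)"
    using assms(1) by (rule sum.image_gen)
  also have "\<dots> = (\<Sum>y\<in>f ` A. n)"
    using assms(2) by (intro sum.cong) auto
  finally show ?thesis by simp
qed

text \<open>Allows orders to be compared one prime at a time, with Sylow subgroups supplying the
  prime powers.\<close>

lemma dvd_if_prime_powers_dvd:
  fixes m n :: nat
  assumes "m \<noteq> 0" "n \<noteq> 0"
    and "\<And>q. Factorial_Ring.prime q \<Longrightarrow> q dvd m \<Longrightarrow> q ^ multiplicity q m dvd n"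
  shows "m dvd n"
proof (rule multiplicity_le_imp_dvd)
  fix q :: nat assume q: "Factorial_Ring.prime q"
  show "multiplicity q m \<le> multiplicity q n"
  proof (cases "q dvd m")
    case True
    then show ?thesis using assms q by (auto intro!: multiplicity_geI)
  next
    case False
    then show ?thesis by (simp add: not_dvd_imp_multiplicity_0)
  qed
qed (use assms in auto)

locale finite_group = group +
  assumes finite_carrier: "finite (carrier G)"

section \<open>Conjugation and products of subgroups\<close>

context group
begin

text \<open>Only inclusion of the conjugates is demanded. When \<open>R\<close> and \<open>P\<close>
  are subgroups, equality follows because \<open>R\<close> is closed under inverses.\<close>

definition normalizes :: "'a set \<Rightarrow> 'a set \<Rightarrow> bool" where
  "normalizes R P \<longleftrightarrow> (\<forall>r\<in>R. \<forall>x\<in>P. r \<otimes> x \<otimes> inv r \<in> P)"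

definition p_subgroup :: "nat \<Rightarrow> 'a set \<Rightarrow> bool" where
  "p_subgroup p P \<longleftrightarrow> subgroup P G \<and> (\<exists>k. card P = p ^ k)"

text \<open>Both \<open>M\<close> and \<open>P\<close> are sets in the ambient group, so Sylow
  subgroups of different subgroups can be compared directly. For a prime \<open>p\<close> not
  dividing \<open>card M\<close> the only such \<open>P\<close> is trivial.\<close>

definition sylow_of :: "nat \<Rightarrow> 'a set \<Rightarrow> 'a set \<Rightarrow> bool" where
  "sylow_of p M P \<longleftrightarrow> subgroup P G \<and> P \<subseteq> M \<and> card P = p ^ multiplicity p (card M)"

abbreviation nilp :: "'a set \<Rightarrow> bool" where
  "nilp M \<equiv> nilpotent_group (G\<lparr>carrier := M\<rparr>)"

lemma inv_cancel_left [simp]: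
  assumes "a \<in> carrier G" "b \<in> carrier G"
  shows "inv a \<otimes> (a \<otimes> b) = b" "a \<otimes> (inv a \<otimes> b) = b"
  using assms by (simp_all add: m_assoc [symmetric])

lemma normal_iff_normalizes: "N \<lhd> G \<longleftrightarrow> subgroup N G \<and> normalizes (carrier G) N"
  unfolding normal_inv_iff normalizes_def by blast

lemma conj_conj:
  assumes "a \<in> carrier G" "b \<in> carrier G" "x \<in> carrier G"
  shows "a \<otimes> (b \<otimes> x \<otimes> inv b) \<otimes> inv a = (a \<otimes> b) \<otimes> x \<otimes> inv (a \<otimes> b)"
  using assms by (simp add: inv_mult_group m_assoc)

lemma conj_eq_iff:
  assumes "g \<in> carrier G" "x \<in> carrier G" "y \<in> carrier G"
  shows "g \<otimes> x \<otimes> inv g = y \<longleftrightarrow> x = inv g \<otimes> y \<otimes> g"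
proof
  assume "g \<otimes> x \<otimes> inv g = y"
  then show "x = inv g \<otimes> y \<otimes> g"
    using assms conj_conj[of "inv g" g x] by auto
next
  assume "x = inv g \<otimes> y \<otimes> g"
  then show "g \<otimes> x \<otimes> inv g = y"
    using assms conj_conj[of g "inv g" y] by auto
qed

lemma inj_on_conj:
  assumes "g \<in> carrier G" "H \<subseteq> carrier G"
  shows "inj_on (\<lambda>x. g \<otimes> x \<otimes> inv g) H"
proof (rule inj_onI)
  fix x y assume xy: "x \<in> H" "y \<in> H" and eq: "g \<otimes> x \<otimes> inv g = g \<otimes> y \<otimes> inv g"
  have xyG: "x \<in> carrier G" "y \<in> carrier G" using xy assms(2) by auto
  have "g \<otimes> x = g \<otimes> y" using eq xyG assms(1) by simp
  then show "x = y" using xyG assms(1) by simp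
qed

lemma conj_hom: "g \<in> carrier G \<Longrightarrow> group_hom G G (\<lambda>x. g \<otimes> x \<otimes> inv g)"
  by unfold_locales (auto simp: hom_def m_assoc)

lemma subgroup_conj:
  assumes "subgroup H G" "g \<in> carrier G"
  shows "subgroup ((\<lambda>x. g \<otimes> x \<otimes> inv g) ` H) G"
  using group_hom.subgroup_img_is_subgroup[OF conj_hom] assms by blast

lemma card_conj:
  assumes "subgroup H G" "g \<in> carrier G"
  shows "card ((\<lambda>x. g \<otimes> x \<otimes> inv g) ` H) = card H"
  using inj_on_conj[OF assms(2) subgroup.subset[OF assms(1)]] by (rule card_image)

lemma card_subgroup_dvd:
  assumes "subgroup H G" "subgroup M G" "H \<subseteq> M"
  shows "card H dvd card M"
proof -
  have "card (rcosets\<^bsub>G\<lparr>carrier := M\<rparr>\<^esub> H) * card H = order (G\<lparr>carrier := M\<rparr>)"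
    by (intro group.lagrange subgroup_imp_group assms subgroup_incl)
  then have "card M = card (rcosets\<^bsub>G\<lparr>carrier := M\<rparr>\<^esub> H) * card H"
    by (simp add: order_def)
  then show ?thesis by simp
qed

text \<open>Multiplication maps \<open>H \<times> K\<close> onto the product set, and the fibre
  through \<open>(h, k)\<close> consists of the pairs
  \<open>(h \<otimes> x, inv x \<otimes> k)\<close> with \<open>x\<close> in the
  intersection.\<close>

lemma card_set_mult:
  assumes H: "subgroup H G" and K: "subgroup K G" and "finite H" "finite K"
  shows "card (H <#> K) * card (H \<inter> K) = card H * card K"
proof -
  define f where "f = (\<lambda>(h, k). h \<otimes> k)"
  have img: "f ` (H \<times> K) = H <#> K"
    by (auto simp: f_def set_mult_def)
  have HG: "h \<in> carrier G" if "h \<in> H" for h by (rule subgroup.mem_carrier[OF H that])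
  have KG: "h \<in> carrier G" if "h \<in> K" for h by (rule subgroup.mem_carrier[OF K that])
  have "card {x \<in> H \<times> K. f x = y} = card (H \<inter> K)" if "y \<in> f ` (H \<times> K)" for y
  proof -
    obtain h k where hk: "h \<in> H" "k \<in> K" "y = h \<otimes> k"
      using \<open>y \<in> f ` (H \<times> K)\<close> by (auto simp: f_def)
    have "bij_betw (\<lambda>x. (h \<otimes> x, inv x \<otimes> k)) (H \<inter> K) {x \<in> H \<times> K. f x = y}"
    proof (rule bij_betwI[where g = "\<lambda>(a, b). inv h \<otimes> a"])
      show "(\<lambda>x. (h \<otimes> x, inv x \<otimes> k)) \<in> H \<inter> K \<rightarrow> {x \<in> H \<times> K. f x = y}"
        using hk HG KG H K
        by (auto simp: f_def subgroup.m_closed subgroup.m_inv_closed m_assoc)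
      show "(\<lambda>(a, b). inv h \<otimes> a) \<in> {x \<in> H \<times> K. f x = y} \<rightarrow> H \<inter> K"
      proof
        fix z assume "z \<in> {x \<in> H \<times> K. f x = y}"
        then obtain a b where ab: "a \<in> H" "b \<in> K" "a \<otimes> b = y" and z: "z = (a, b)"
          by (auto simp: f_def)
        have eq: "inv h \<otimes> a = k \<otimes> inv b"
        proof -
          have "inv h \<otimes> a = inv h \<otimes> (a \<otimes> b) \<otimes> inv b"
            using ab(1,2) hk HG KG by (simp add: m_assoc)
          also have "\<dots> = inv h \<otimes> (h \<otimes> k) \<otimes> inv b"
            by (simp only: ab hk)
          also have "\<dots> = k \<otimes> inv b"
            using hk HG KG by simp
          finally show ?thesis .
        qed
        have "inv h \<otimes> a \<in> H" "k \<otimes> inv b \<in> K"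
          using ab hk H K by (simp_all add: subgroup.m_closed subgroup.m_inv_closed)
        then show "(case z of (a, b) \<Rightarrow> inv h \<otimes> a) \<in> H \<inter> K"
          using eq z by simp
      qed
      show "(case (h \<otimes> x, inv x \<otimes> k) of (a, b) \<Rightarrow> inv h \<otimes> a) = x" if "x \<in> H \<inter> K" for x
        using that hk HG by simp
      show "(h \<otimes> (case x of (a, b) \<Rightarrow> inv h \<otimes> a), inv (case x of (a, b) \<Rightarrow> inv h \<otimes> a) \<otimes> k) = x"
        if x: "x \<in> {x \<in> H \<times> K. f x = y}" for x
      proof -
        obtain a b where ab: "x = (a, b)" "a \<in> H" "b \<in> K" "a \<otimes> b = h \<otimes> k"
          using x hk by (auto simp: f_def)
        have "inv (inv h \<otimes> a) \<otimes> k = inv a \<otimes> (h \<otimes> k)"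
          using ab hk HG KG by (simp add: inv_mult_group m_assoc)
        also have "\<dots> = b"
          using ab hk HG KG by (metis inv_cancel_left(1))
        finally show ?thesis
          using ab hk HG KG by simp
      qed
    qed
    then show ?thesis by (simp add: bij_betw_same_card)
  qed
  then have "card (H \<times> K) = card (f ` (H \<times> K)) * card (H \<inter> K)"
    using assms by (intro card_eq_card_image_mult) auto
  then show ?thesis by (simp add: img card_cartesian_product)
qed

lemma subgroup_set_mult:
  assumes H: "subgroup H G" and K: "subgroup K G" and "normalizes K H"
  shows "subgroup (H <#> K) G"
proof (rule subgroupI)
  have HG: "h \<in> carrier G" if "h \<in> H" for h by (rule subgroup.mem_carrier[OF H that])
  have KG: "h \<in> carrier G" if "h \<in> K" for h by (rule subgroup.mem_carrier[OF K that])
  have c: "k \<otimes> h \<otimes> inv k \<in> H" if "h \<in> H" "k \<in> K" for h k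
    using assms(3) that unfolding normalizes_def by blast
  show "H <#> K \<subseteq> carrier G" using HG KG by (auto simp: set_mult_def)
  show "H <#> K \<noteq> {}" using subgroup.one_closed[OF H] subgroup.one_closed[OF K]
    by (auto simp: set_mult_def)
  fix a assume "a \<in> H <#> K"
  then obtain h k where hk: "h \<in> H" "k \<in> K" "a = h \<otimes> k" by (auto simp: set_mult_def)
  have "inv a = (inv k \<otimes> inv h \<otimes> inv (inv k)) \<otimes> inv k"
    using hk HG KG by (simp add: inv_mult_group m_assoc)
  moreover have "inv k \<otimes> inv h \<otimes> inv (inv k) \<in> H" "inv k \<in> K"
    using c[of "inv h" "inv k"] hk by (simp_all add: subgroup.m_inv_closed[OF H] subgroup.m_inv_closed[OF K])
  ultimately show "inv a \<in> H <#> K" by (auto simp: set_mult_def)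
  fix b assume "b \<in> H <#> K"
  then obtain h' k' where hk': "h' \<in> H" "k' \<in> K" "b = h' \<otimes> k'" by (auto simp: set_mult_def)
  have "a \<otimes> b = (h \<otimes> (k \<otimes> h' \<otimes> inv k)) \<otimes> (k \<otimes> k')"
    using hk hk' HG KG by (simp add: m_assoc)
  moreover have "h \<otimes> (k \<otimes> h' \<otimes> inv k) \<in> H" "k \<otimes> k' \<in> K"
    using c[of h' k] hk hk' H K by (auto intro: subgroup.m_closed)
  ultimately show "a \<otimes> b \<in> H <#> K" by (auto simp: set_mult_def)
qed

lemma subset_set_mult:
  assumes "subgroup H G" "subgroup K G"
  shows "H \<subseteq> H <#> K" "K \<subseteq> H <#> K"
proof -
  have "h \<in> H <#> K" if "h \<in> H" for h
    using that subgroup.one_closed[OF assms(2)] subgroup.mem_carrier[OF assms(1) that]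
    unfolding set_mult_def by force
  moreover have "h \<in> H <#> K" if "h \<in> K" for h
    using that subgroup.one_closed[OF assms(1)] subgroup.mem_carrier[OF assms(2) that]
    unfolding set_mult_def by force
  ultimately show "H \<subseteq> H <#> K" "K \<subseteq> H <#> K" by auto
qed

lemma set_mult_subset:
  assumes "subgroup M G" "H \<subseteq> M" "K \<subseteq> M"
  shows "H <#> K \<subseteq> M"
  using assms by (auto simp: set_mult_def intro!: subgroup.m_closed)

lemma normal_set_mult:
  assumes "H \<lhd> G" "K \<lhd> G"
  shows "H <#> K \<lhd> G"
proof -
  have H: "subgroup H G" and K: "subgroup K G"
    using assms by (auto dest: normal_imp_subgroup)
  have n: "normalizes (carrier G) H" "normalizes (carrier G) K"
    using assms by (auto simp: normal_iff_normalizes)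
  have "normalizes K H"
    using n subgroup.subset[OF K] unfolding normalizes_def by blast
  moreover have "g \<otimes> x \<otimes> inv g \<in> H <#> K" if g: "g \<in> carrier G" and x: "x \<in> H <#> K" for g x
  proof -
    obtain h k where hk: "h \<in> H" "k \<in> K" "x = h \<otimes> k"
      using x unfolding set_mult_def by blast
    have "g \<otimes> x \<otimes> inv g = (g \<otimes> h \<otimes> inv g) \<otimes> (g \<otimes> k \<otimes> inv g)"
      using hk g subgroup.mem_carrier[OF H] subgroup.mem_carrier[OF K]
      by (simp add: m_assoc)
    moreover have "g \<otimes> h \<otimes> inv g \<in> H" "g \<otimes> k \<otimes> inv g \<in> K"
      using n hk g unfolding normalizes_def by blast+
    ultimately show ?thesis by (auto simp: set_mult_def)
  qed
  ultimately show ?thesis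
    using subgroup_set_mult[OF H K] by (simp add: normal_iff_normalizes normalizes_def)
qed

end

section \<open>Sylow subgroups\<close>

text \<open>Orbit sizes divide \<open>p ^ k\<close>. Without a fixed point every orbit would have
  size divisible by \<open>p\<close>, and so would \<open>E\<close>, their disjoint union.\<close>

lemma (in group_action) p_group_fixed_point:
  assumes p: "Factorial_Ring.prime p" and ord: "order G = p ^ k"
    and fin: "finite E" and ndvd: "\<not> p dvd card E"
  shows "\<exists>x\<in>E. \<forall>g\<in>carrier G. \<phi> g x = x"
proof (rule ccontr)
  assume no_fix: "\<not> ?thesis"
  have grp: "group G" using group_hom group_hom.axioms(1) by blast
  have "p dvd card orb" if orb: "orb \<in> orbits G E \<phi>" for orb
  proof -
    obtain x where x: "x \<in> E" "orb = orbit G \<phi> x"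
      using orb unfolding orbits_def by blast
    obtain g where g: "g \<in> carrier G" "\<phi> g x \<noteq> x"
      using no_fix x by blast
    have "card orb * card (stabilizer G \<phi> x) = p ^ k"
      using orbit_stabilizer_theorem[OF x(1)] x(2) ord by simp
    then obtain i where i: "card orb = p ^ i"
      using p divides_primepow_nat by (metis dvd_triv_left)
    \<comment> \<open>Two distinct points in the orbit exclude the exponent 0.\<close>
    have "{x, \<phi> g x} \<subseteq> orb"
      using x g orbit_refl[OF x(1)] by (auto simp: orbit_def)
    moreover have "finite orb"
      using fin x orbits_coverture orb by (metis Union_upper finite_subset)
    ultimately have "card {x, \<phi> g x} \<le> card orb" by (intro card_mono)
    then have "i \<noteq> 0" using g(2) i by (cases i) auto
    then show ?thesis using i by simp
  qed
  then have "p dvd card (\<Union> (orbits G E \<phi>))"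
    using fin disjoint_union by (intro dvd_partition) (auto simp: orbits_coverture)
  then show False using ndvd by (simp add: orbits_coverture)
qed

section \<open>Normalizers and conjugacy of Sylow subgroups\<close>

context finite_group
begin

lemma finite_subgroup: "subgroup H G \<Longrightarrow> finite H"
  using finite_carrier finite_subset subgroup.subset by blast

lemma card_subgroup_pos: "subgroup H G \<Longrightarrow> card H > 0"
  using finite_carrier subgroup.finite_imp_card_positive by blast

lemma finite_group_restrict: "subgroup M G \<Longrightarrow> finite_group (G\<lparr>carrier := M\<rparr>)"
  using subgroup_imp_group finite_subgroup
  by (auto simp: finite_group_def finite_group_axioms_def)

text \<open>The normalizer is defined as a stabilizer, by equality of a conjugate with
  \<open>H\<close>. Finiteness reduces this to inclusion, since conjugates have equal
  cardinality.\<close>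

lemma mem_normalizer_iff:
  assumes H: "subgroup H G"
  shows "g \<in> normalizer G H \<longleftrightarrow> g \<in> carrier G \<and> (\<forall>h\<in>H. g \<otimes> h \<otimes> inv g \<in> H)"
proof -
  have img: "g <# H #> inv g = (\<lambda>h. g \<otimes> h \<otimes> inv g) ` H"
    by (auto simp: l_coset_def r_coset_def)
  have "(\<lambda>h. g \<otimes> h \<otimes> inv g) ` H = H" if "g \<in> carrier G" "\<forall>h\<in>H. g \<otimes> h \<otimes> inv g \<in> H"
    using that by (intro card_subset_eq finite_subgroup H card_conj) auto
  then show ?thesis
    using subgroup.subset[OF H] by (auto simp: normalizer_def stabilizer_def img)
qed

lemma subgroup_normalizer: "subgroup H G \<Longrightarrow> subgroup (normalizer G H) G"
  using normalizer_imp_subgroup subgroup.subset by blast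

lemma subset_normalizer: "subgroup H G \<Longrightarrow> H \<subseteq> normalizer G H"
  by (auto simp: mem_normalizer_iff subgroup.m_closed subgroup.m_inv_closed subgroup.mem_carrier)

lemma normalizes_iff_subset_normalizer:
  "subgroup H G \<Longrightarrow> R \<subseteq> carrier G \<Longrightarrow> normalizes R H \<longleftrightarrow> R \<subseteq> normalizer G H"
  by (auto simp: mem_normalizer_iff normalizes_def)

lemma normalizes_normalizer: "subgroup H G \<Longrightarrow> normalizes (normalizer G H) H"
  by (auto simp: mem_normalizer_iff normalizes_def)

lemma normal_iff_normalizer_eq: "subgroup H G \<Longrightarrow> H \<lhd> G \<longleftrightarrow> normalizer G H = carrier G"
  using normalizes_iff_subset_normalizer[of H "carrier G"] subgroup.subset[OF subgroup_normalizer]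
  by (auto simp: normal_iff_normalizes)

lemma p_subgroup_subgroup:
  assumes "Factorial_Ring.prime p" "p_subgroup p P" "subgroup H G" "H \<subseteq> P"
  shows "p_subgroup p H"
  using assms card_subgroup_dvd[of H P] divides_primepow_nat unfolding p_subgroup_def by metis

lemma p_subgroup_set_mult:
  assumes "Factorial_Ring.prime p" "p_subgroup p P" "p_subgroup p R" "normalizes R P"
  shows "p_subgroup p (P <#> R)"
proof -
  have P: "subgroup P G" and R: "subgroup R G"
    using assms by (auto simp: p_subgroup_def)
  obtain i j where ij: "card P = p ^ i" "card R = p ^ j"
    using assms by (auto simp: p_subgroup_def)
  have "card (P <#> R) * card (P \<inter> R) = p ^ (i + j)"
    using card_set_mult[OF P R] finite_subgroup P R ij by (simp add: power_add)
  then have "\<exists>k. card (P <#> R) = p ^ k"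
    using assms(1) divides_primepow_nat by (metis dvd_triv_left)
  then show ?thesis
    using subgroup_set_mult[OF P R assms(4)] by (simp add: p_subgroup_def)
qed

lemma sylow_of_imp_p_subgroup: "sylow_of p M P \<Longrightarrow> p_subgroup p P"
  by (auto simp: sylow_of_def p_subgroup_def)

lemma sylow_of_maximal:
  assumes "Factorial_Ring.prime p" "subgroup M G" "sylow_of p M P"
    and "p_subgroup p R" "P \<subseteq> R" "R \<subseteq> M"
  shows "R = P"
proof -
  obtain k where k: "card R = p ^ k" and R: "subgroup R G"
    using assms by (auto simp: p_subgroup_def)
  have "p ^ k dvd card M"
    using card_subgroup_dvd[OF R assms(2,6)] k by simp
  moreover have "card M \<noteq> 0" "\<not> is_unit p"
    using card_subgroup_pos[OF assms(2)] assms(1) by auto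
  ultimately have "k \<le> multiplicity p (card M)"
    by (simp add: multiplicity_geI)
  then have "card R \<le> card P"
    using k assms by (auto simp: sylow_of_def prime_gt_0_nat power_increasing Suc_leI)
  then show ?thesis
    using card_seteq[OF finite_subgroup[OF R] assms(5)] by simp
qed

text \<open>The product of \<open>P\<close> and \<open>R\<close> is a \<open>p\<close>-subgroup of
  \<open>M\<close> containing \<open>P\<close>, hence equal to \<open>P\<close> by
  maximality.\<close>

lemma sylow_of_contains:
  assumes "Factorial_Ring.prime p" "subgroup M G" "sylow_of p M P"
    and "p_subgroup p R" "R \<subseteq> M" "normalizes R P"
  shows "R \<subseteq> P"
proof -
  have P: "subgroup P G" "P \<subseteq> M" and R: "subgroup R G"
    using assms by (auto simp: sylow_of_def p_subgroup_def)
  have "P <#> R = P"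
    using assms P R subset_set_mult[OF P(1) R]
    by (intro sylow_of_maximal[OF assms(1-3)] p_subgroup_set_mult sylow_of_imp_p_subgroup[OF assms(3)]
        set_mult_subset) auto
  then show ?thesis
    using subset_set_mult[OF P(1) R] by simp
qed

lemma sylow_of_normal_contains:
  assumes "Factorial_Ring.prime p" "subgroup M G" "sylow_of p M P"
    and "p_subgroup p R" "R \<subseteq> M" "normalizes M P"
  shows "R \<subseteq> P"
  using sylow_of_contains[OF assms(1-5)] assms(5,6) by (auto simp: normalizes_def)

lemma sylow_of_exists:
  assumes "Factorial_Ring.prime p" "subgroup M G"
  shows "\<exists>P. sylow_of p M P"
proof -
  have "card M = p ^ multiplicity p (card M) * (card M div p ^ multiplicity p (card M))"
    by (simp add: multiplicity_dvd)
  then obtain P where "subgroup P (G\<lparr>carrier := M\<rparr>)" "card P = p ^ multiplicity p (card M)"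
    using sylow_thm[OF assms(1) subgroup_imp_group[OF assms(2)]] finite_subgroup[OF assms(2)]
    by (auto simp: order_def)
  then show ?thesis
    using incl_subgroup[OF assms(2)] subgroup.subset by (fastforce simp: sylow_of_def)
qed

lemma sylow_of_conj:
  assumes "K \<lhd> G" "sylow_of p K P" "g \<in> carrier G"
  shows "sylow_of p K ((\<lambda>x. g \<otimes> x \<otimes> inv g) ` P)"
  using assms subgroup_conj[of P g] card_conj[of P g]
  by (auto simp: sylow_of_def normal_iff_normalizes normalizes_def)

lemma p_subgroup_conj:
  assumes "p_subgroup p P" "g \<in> carrier G"
  shows "p_subgroup p ((\<lambda>x. g \<otimes> x \<otimes> inv g) ` P)"
  using assms subgroup_conj[of P g] card_conj[of P g] by (auto simp: p_subgroup_def)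

text \<open>A normal Sylow subgroup of \<open>K\<close> contains every \<open>p\<close>-subgroup of
  \<open>K\<close>, in particular its conjugates under \<open>G\<close>, which stay inside the
  normal subgroup \<open>K\<close>.\<close>

lemma normal_sylow_of_normal:
  assumes "Factorial_Ring.prime p" "K \<lhd> G" "sylow_of p K P" "normalizes K P"
  shows "P \<lhd> G"
proof -
  have "g \<otimes> x \<otimes> inv g \<in> P" if "g \<in> carrier G" "x \<in> P" for g x
  proof -
    have c: "sylow_of p K ((\<lambda>x. g \<otimes> x \<otimes> inv g) ` P)"
      using sylow_of_conj assms that by blast
    then have "(\<lambda>x. g \<otimes> x \<otimes> inv g) ` P \<subseteq> P"
      by (intro sylow_of_normal_contains[OF assms(1) normal_imp_subgroup[OF assms(2)] assms(3) _ _ assms(4)])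
        (auto simp: sylow_of_imp_p_subgroup sylow_of_def)
    then show ?thesis using that by blast
  qed
  then show ?thesis
    using assms(3) by (simp add: normal_iff_normalizes sylow_of_def normalizes_def)
qed

text \<open>The inverse turns multiplication from the right into a left action. The maps are
  restricted to the set of cosets because elements of \<open>Bij\<close> are extensional.\<close>

lemma action_on_rcosets:
  assumes P: "subgroup P G" and R: "subgroup R G"
  shows "group_action (G\<lparr>carrier := R\<rparr>) (rcosets P) (\<lambda>r. \<lambda>C\<in>rcosets P. C #> inv r)"
proof -
  have RG: "r \<in> carrier G" if "r \<in> R" for r by (rule subgroup.mem_carrier[OF R that])
  have sub: "C \<subseteq> carrier G" if "C \<in> rcosets P" for C
    using that subgroup.rcosets_carrier[OF P] group_axioms by blast
  have cl: "C #> g \<in> rcosets P" if "C \<in> rcosets P" "g \<in> carrier G" for C g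
    using that subgroup.subset[OF P] by (auto simp: RCOSETS_def coset_mult_assoc)
  have bij: "(\<lambda>C\<in>rcosets P. C #> inv r) \<in> Bij (rcosets P)" if "r \<in> R" for r
  proof -
    have "bij_betw (\<lambda>C. C #> inv r) (rcosets P) (rcosets P)"
      using RG[OF that] sub cl
      by (intro bij_betwI[where g = "\<lambda>C. C #> r"]) (auto simp: coset_mult_assoc)
    then show ?thesis by (auto simp: Bij_def)
  qed
  show ?thesis
    unfolding group_action_def group_hom_def group_hom_axioms_def
  proof (intro conjI homI)
    show "group (G\<lparr>carrier := R\<rparr>)" using R by (rule subgroup_imp_group)
    show "group (BijGroup (rcosets P))" by (rule group_BijGroup)
    show "(\<lambda>C\<in>rcosets P. C #> inv r) \<in> carrier (BijGroup (rcosets P))"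
      if "r \<in> carrier (G\<lparr>carrier := R\<rparr>)" for r
      using bij that by (simp add: BijGroup_def)
    fix r s assume "r \<in> carrier (G\<lparr>carrier := R\<rparr>)" "s \<in> carrier (G\<lparr>carrier := R\<rparr>)"
    then have rs: "r \<in> R" "s \<in> R" by auto
    have "(\<lambda>C\<in>rcosets P. C #> inv (r \<otimes> s)) =
        compose (rcosets P) (\<lambda>C\<in>rcosets P. C #> inv r) (\<lambda>C\<in>rcosets P. C #> inv s)"
      using rs RG sub cl
      by (auto simp: compose_def fun_eq_iff inv_mult_group coset_mult_assoc)
    then show "(\<lambda>C\<in>rcosets P. C #> inv (r \<otimes>\<^bsub>G\<lparr>carrier := R\<rparr>\<^esub> s)) =
        (\<lambda>C\<in>rcosets P. C #> inv r) \<otimes>\<^bsub>BijGroup (rcosets P)\<^esub> (\<lambda>C\<in>rcosets P. C #> inv s)"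
      using rs bij by (simp add: BijGroup_def)
  qed
qed

text \<open>The \<open>p\<close>-group \<open>R\<close> acts on the cosets of \<open>P\<close>,
  whose number is prime to \<open>p\<close>, and so fixes some coset \<open>P #> g\<close>. This
  says that \<open>g\<close> conjugates \<open>R\<close> into \<open>P\<close>.\<close>

lemma sylow_conj_carrier:
  assumes p: "Factorial_Ring.prime p" and P: "sylow_of p (carrier G) P" and R: "p_subgroup p R"
  shows "\<exists>g\<in>carrier G. \<forall>r\<in>R. g \<otimes> r \<otimes> inv g \<in> P"
proof -
  have PG: "subgroup P G" and RG: "subgroup R G"
    using P R by (auto simp: sylow_of_def p_subgroup_def)
  interpret act: group_action "G\<lparr>carrier := R\<rparr>" "rcosets P" "\<lambda>r. \<lambda>C\<in>rcosets P. C #> inv r"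
    using PG RG by (rule action_on_rcosets)
  have idx: "card (rcosets P) * card P = order G"
    using PG by (rule lagrange)
  have "\<not> p dvd card (rcosets P)"
  proof
    assume "p dvd card (rcosets P)"
    then have "p ^ Suc (multiplicity p (order G)) dvd order G"
      using idx P by (metis mult_dvd_mono dvd_refl power_Suc sylow_of_def order_def)
    moreover have "order G \<noteq> 0" using finite_carrier order_gt_0_iff_finite by auto
    moreover have "\<not> is_unit p" using p by auto
    ultimately show False
      using multiplicity_geI[where p = p and x = "order G" and n = "Suc (multiplicity p (order G))"] by simp
  qed
  moreover obtain k where k: "order (G\<lparr>carrier := R\<rparr>) = p ^ k"
    using R by (auto simp: p_subgroup_def order_def)
  moreover have "finite (rcosets P)"
    using finite_carrier rcosets_subset_PowG[OF PG] finite_subset by blast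
  ultimately obtain C where C: "C \<in> rcosets P" "\<forall>r\<in>R. C #> inv r = C"
    using act.p_group_fixed_point[OF p k] by auto
  obtain g where g: "g \<in> carrier G" "C = P #> g"
    using C(1) by (auto simp: RCOSETS_def)
  have "g \<otimes> r \<otimes> inv g \<in> P" if "r \<in> R" for r
  proof -
    have r: "r \<in> carrier G" "inv r \<in> R" using RG that
      by (auto simp: subgroup.mem_carrier subgroup.m_inv_closed)
    have "P #> g #> r = P #> g"
      using C(2) r g by fastforce
    then have "P #> (g \<otimes> r) = P #> g"
      using r g subgroup.subset[OF PG] by (simp add: coset_mult_assoc)
    then have "g \<otimes> r \<in> P #> g"
      using r g PG by (metis m_closed rcos_self)
    then obtain h where h: "h \<in> P" "g \<otimes> r = h \<otimes> g" by (auto simp: r_coset_def)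
    then have "g \<otimes> r \<otimes> inv g = h"
      using g r subgroup.mem_carrier[OF PG] by (simp add: m_assoc)
    then show ?thesis using h by simp
  qed
  then show ?thesis using g by blast
qed

lemma sylow_conj:
  assumes p: "Factorial_Ring.prime p" and M: "subgroup M G" and P: "sylow_of p M P"
    and R: "p_subgroup p R" "R \<subseteq> M"
  shows "\<exists>g\<in>M. \<forall>r\<in>R. g \<otimes> r \<otimes> inv g \<in> P"
proof -
  interpret M: finite_group "G\<lparr>carrier := M\<rparr>"
    using M by (rule finite_group_restrict)
  have "M.sylow_of p (carrier (G\<lparr>carrier := M\<rparr>)) P" "M.p_subgroup p R"
    using P R M subgroup_incl by (auto simp: M.sylow_of_def M.p_subgroup_def sylow_of_def p_subgroup_def)
  from M.sylow_conj_carrier[OF p this] show ?thesis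
    using M by (auto simp: m_inv_consistent)
qed

text \<open>A conjugate of \<open>Q\<close> under \<open>g\<close> is again Sylow in
  \<open>K\<close>, so some \<open>k\<close> in \<open>K\<close> brings it back to \<open>Q\<close>,
  and \<open>k \<otimes> g\<close> normalizes \<open>Q\<close>. Hence \<open>G\<close> is the
  product of \<open>K\<close> and the normalizer; only the resulting relation of orders is
  recorded.\<close>

lemma frattini:
  assumes "Factorial_Ring.prime q" "K \<lhd> G" "sylow_of q K Q"
  shows "order G dvd card K * card (normalizer G Q)"
proof -
  have K: "subgroup K G" and Q: "subgroup Q G" "Q \<subseteq> K"
    using assms by (auto simp: sylow_of_def normal_imp_subgroup)
  have N: "subgroup (normalizer G Q) G" using Q by (simp add: subgroup_normalizer)
  have "carrier G \<subseteq> K <#> normalizer G Q"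
  proof
    fix g assume g: "g \<in> carrier G"
    have "sylow_of q K ((\<lambda>x. g \<otimes> x \<otimes> inv g) ` Q)"
      using sylow_of_conj assms g by blast
    then obtain k where k: "k \<in> K" "\<forall>r\<in>(\<lambda>x. g \<otimes> x \<otimes> inv g) ` Q. k \<otimes> r \<otimes> inv k \<in> Q"
      using sylow_conj[OF assms(1) K assms(3)] sylow_of_imp_p_subgroup unfolding sylow_of_def by meson
    have kG: "k \<in> carrier G" using k K by (simp add: subgroup.mem_carrier)
    have "k \<otimes> g \<in> normalizer G Q"
      using k g kG subgroup.mem_carrier[OF Q(1)] by (auto simp: mem_normalizer_iff[OF Q(1)] conj_conj)
    moreover have "g = inv k \<otimes> (k \<otimes> g)" "inv k \<in> K"
      using k g kG K by (simp_all add: subgroup.m_inv_closed)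
    ultimately show "g \<in> K <#> normalizer G Q" by (auto simp: set_mult_def)
  qed
  then have "K <#> normalizer G Q = carrier G"
    using set_mult_subset[OF subgroup_self] subgroup.subset K N by blast
  then show ?thesis
    using card_set_mult[OF K N] finite_subgroup K N by (metis dvd_triv_left order_def)
qed

end

section \<open>Nilpotent groups\<close>

lemma lower_central_step_mono:
  "group G \<Longrightarrow> H \<subseteq> K \<Longrightarrow> lower_central_step G H \<subseteq> lower_central_step G K"
  unfolding lower_central_step_def by (intro group.mono_generate UN_mono) auto

lemma (in group) lower_central_step_in_carrier:
  "H \<subseteq> carrier G \<Longrightarrow> lower_central_step G H \<subseteq> carrier G"
  unfolding lower_central_step_def by (intro generate_incl) auto

lemma (in group) lower_central_step_funpow_in_carrier:
  "(lower_central_step G ^^ n) (carrier G) \<subseteq> carrier G"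
  by (induction n) (simp_all add: lower_central_step_in_carrier)

lemma (in group) one_mem_lower_central_step_funpow:
  "\<one> \<in> (lower_central_step G ^^ n) (carrier G)"
  by (cases n) (simp_all add: lower_central_step_def generate.one)

context group
begin

lemma lower_central_step_restrict_subset:
  assumes M: "subgroup M G" and H: "H \<subseteq> M"
  shows "lower_central_step (G\<lparr>carrier := M\<rparr>) H \<subseteq> lower_central_step G H"
proof -
  have "(\<Union>h\<in>H. \<Union>g\<in>M. {h \<otimes> g \<otimes> inv\<^bsub>G\<lparr>carrier := M\<rparr>\<^esub> h \<otimes> inv\<^bsub>G\<lparr>carrier := M\<rparr>\<^esub> g}) =
        (\<Union>h\<in>H. \<Union>g\<in>M. {h \<otimes> g \<otimes> inv h \<otimes> inv g})"
    using H M by (intro SUP_cong refl) (auto simp: m_inv_consistent)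
  moreover have "(\<Union>h\<in>H. \<Union>g\<in>M. {h \<otimes> g \<otimes> inv h \<otimes> inv g}) \<subseteq> M"
    using H M by (auto intro!: subgroup.m_closed subgroup.m_inv_closed)
  ultimately have "lower_central_step (G\<lparr>carrier := M\<rparr>) H =
      generate G (\<Union>h\<in>H. \<Union>g\<in>M. {h \<otimes> g \<otimes> inv h \<otimes> inv g})"
    using generate_consistent[OF _ M] by (simp add: lower_central_step_def)
  also have "\<dots> \<subseteq> lower_central_step G H"
    using subgroup.subset[OF M] unfolding lower_central_step_def
    by (intro mono_generate UN_mono) auto
  finally show ?thesis .
qed

text \<open>The lower central series of \<open>M\<close> lies term by term inside that of
  \<open>G\<close>.\<close>

lemma nilpotent_subgroup:
  assumes nil: "nilpotent_group G" and M: "subgroup M G"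
  shows "nilp M"
proof -
  interpret M: group "G\<lparr>carrier := M\<rparr>" using M by (rule subgroup_imp_group)
  have sub: "(lower_central_step (G\<lparr>carrier := M\<rparr>) ^^ n) M \<subseteq> (lower_central_step G ^^ n) (carrier G)" for n
  proof (induction n)
    case (Suc n)
    have "(lower_central_step (G\<lparr>carrier := M\<rparr>) ^^ n) M \<subseteq> M"
      using M.lower_central_step_funpow_in_carrier[of n] by simp
    then have "(lower_central_step (G\<lparr>carrier := M\<rparr>) ^^ Suc n) M \<subseteq>
        lower_central_step G ((lower_central_step (G\<lparr>carrier := M\<rparr>) ^^ n) M)"
      using lower_central_step_restrict_subset[OF M] by simp
    also have "\<dots> \<subseteq> lower_central_step G ((lower_central_step G ^^ n) (carrier G))"
      using Suc by (intro lower_central_step_mono) (simp_all add: group_axioms)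
    finally show ?case by simp
  qed (simp add: subgroup.subset[OF M])
  obtain n where "(lower_central_step G ^^ n) (carrier G) = {\<one>}"
    using nil unfolding nilpotent_group_def by blast
  then have "(lower_central_step (G\<lparr>carrier := M\<rparr>) ^^ n) M = {\<one>}"
    using sub[of n] M.one_mem_lower_central_step_funpow[of n] by auto
  then show ?thesis by (auto simp: nilpotent_group_def)
qed

lemma nilp_subset:
  assumes "nilp M" "subgroup M G" "subgroup H G" "H \<subseteq> M"
  shows "nilp H"
  using group.nilpotent_subgroup[OF subgroup_imp_group[OF assms(2)] assms(1) subgroup_incl[OF assms(3,2,4)]]
  by simp

text \<open>Take the last term \<open>L i\<close> of the lower central series of \<open>M\<close>
  that is not inside \<open>H\<close>. Commutators of its elements with \<open>M\<close> lie in
  \<open>L (Suc i)\<close>, hence in \<open>H\<close>, so every element of \<open>L i\<close>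
  normalizes \<open>H\<close>.\<close>

lemma nilp_normalizer_grows:
  assumes nil: "nilp M" and M: "subgroup M G" and H: "subgroup H G" "H \<subseteq> M" "H \<noteq> M"
  shows "\<exists>g\<in>M - H. \<forall>h\<in>H. g \<otimes> h \<otimes> inv g \<in> H"
proof -
  interpret M: group "G\<lparr>carrier := M\<rparr>" using M by (rule subgroup_imp_group)
  define L where "L = (\<lambda>n. (lower_central_step (G\<lparr>carrier := M\<rparr>) ^^ n) M)"
  obtain n where "L n = {\<one>}"
    using nil by (auto simp: nilpotent_group_def L_def)
  then have "L n \<subseteq> H" using subgroup.one_closed[OF H(1)] by simp
  moreover have "\<not> L 0 \<subseteq> H" using H by (simp add: L_def)
  ultimately obtain i where i: "\<not> L i \<subseteq> H" "L (Suc i) \<subseteq> H"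
    using nat_induct[of "\<lambda>n. \<not> L n \<subseteq> H" n] by blast
  then obtain g where g: "g \<in> L i" "g \<notin> H" by blast
  have gM: "g \<in> M" using g M.lower_central_step_funpow_in_carrier[of i] by (auto simp: L_def)
  have "g \<otimes> h \<otimes> inv g \<in> H" if h: "h \<in> H" for h
  proof -
    have hM: "h \<in> M" using h H by blast
    have "g \<otimes> h \<otimes> inv g \<otimes> inv h \<in> L (Suc i)"
    proof -
      have "g \<otimes> h \<otimes> inv\<^bsub>G\<lparr>carrier := M\<rparr>\<^esub> g \<otimes> inv\<^bsub>G\<lparr>carrier := M\<rparr>\<^esub> h \<in> lower_central_step (G\<lparr>carrier := M\<rparr>) (L i)"
        using g hM unfolding lower_central_step_def by (intro generate.incl) auto
      then show ?thesis
        using gM hM by (simp add: L_def m_inv_consistent[OF M])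
    qed
    then have "g \<otimes> h \<otimes> inv g \<otimes> inv h \<otimes> h \<in> H"
      using i h H(1) by (auto intro: subgroup.m_closed)
    then show ?thesis
      using gM hM subgroup.mem_carrier[OF M] by (simp add: m_assoc)
  qed
  then show ?thesis using g gM by blast
qed

end

text \<open>A surjective homomorphism carries each term of the lower central series onto the
  corresponding term of the image.\<close>

lemma (in group_hom) nilpotent_surj_image:
  assumes surj: "h ` carrier G = carrier H" and nil: "nilpotent_group G"
  shows "nilpotent_group H"
proof -
  have step: "lower_central_step H (h ` A) = h ` lower_central_step G A" if "A \<subseteq> carrier G" for A
  proof -
    have "(\<Union>x\<in>h ` A. \<Union>g\<in>carrier H. {x \<otimes>\<^bsub>H\<^esub> g \<otimes>\<^bsub>H\<^esub> inv\<^bsub>H\<^esub> x \<otimes>\<^bsub>H\<^esub> inv\<^bsub>H\<^esub> g}) =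
      h ` (\<Union>x\<in>A. \<Union>g\<in>carrier G. {x \<otimes>\<^bsub>G\<^esub> g \<otimes>\<^bsub>G\<^esub> inv\<^bsub>G\<^esub> x \<otimes>\<^bsub>G\<^esub> inv\<^bsub>G\<^esub> g})"
      using that unfolding surj[symmetric] by (force simp: image_UN)
    moreover have "(\<Union>x\<in>A. \<Union>g\<in>carrier G. {x \<otimes>\<^bsub>G\<^esub> g \<otimes>\<^bsub>G\<^esub> inv\<^bsub>G\<^esub> x \<otimes>\<^bsub>G\<^esub> inv\<^bsub>G\<^esub> g}) \<subseteq> carrier G"
      using that by (auto simp: subset_iff)
    ultimately show ?thesis
      unfolding lower_central_step_def by (simp add: generate_img)
  qed
  have "(lower_central_step H ^^ n) (carrier H) = h ` (lower_central_step G ^^ n) (carrier G)" for n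
    by (induction n) (simp_all add: surj step G.lower_central_step_funpow_in_carrier)
  moreover obtain n where "(lower_central_step G ^^ n) (carrier G) = {\<one>\<^bsub>G\<^esub>}"
    using nil unfolding nilpotent_group_def by blast
  ultimately show ?thesis
    unfolding nilpotent_group_def by (intro exI[of _ n]) simp
qed

context finite_group
begin

text \<open>Let \<open>N\<close> be the normalizer of \<open>P\<close> in \<open>M\<close>. Whatever
  normalizes \<open>N\<close> conjugates \<open>P\<close> to a \<open>p\<close>-subgroup of
  \<open>N\<close>, hence into \<open>P\<close>, and so lies in \<open>N\<close> already. In a
  nilpotent \<open>M\<close> such a self-normalizing \<open>N\<close> must be
  \<open>M\<close>.\<close>

lemma nilp_sylow_normal:
  assumes p: "Factorial_Ring.prime p" and nil: "nilp M" and M: "subgroup M G" and P: "sylow_of p M P"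
  shows "normalizes M P"
proof -
  have PG: "subgroup P G" "P \<subseteq> M" using P by (auto simp: sylow_of_def)
  define N where "N = M \<inter> normalizer G P"
  have N: "subgroup N G"
    unfolding N_def using M PG by (intro subgroups_Inter_pair subgroup_normalizer)
  have PN: "P \<subseteq> N" using PG subset_normalizer by (auto simp: N_def)
  have nor: "normalizes N P"
    using normalizes_normalizer[OF PG(1)] by (auto simp: N_def normalizes_def)
  have "N = M"
  proof (rule ccontr)
    assume "N \<noteq> M"
    then obtain g where g: "g \<in> M" "g \<notin> N" "\<forall>h\<in>N. g \<otimes> h \<otimes> inv g \<in> N"
      using nilp_normalizer_grows[OF nil M N] by (auto simp: N_def)
    have gG: "g \<in> carrier G" by (rule subgroup.mem_carrier[OF M g(1)])
    define R where "R = (\<lambda>x. g \<otimes> x \<otimes> inv g) ` P"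
    have "R \<subseteq> N" using g PN by (auto simp: R_def)
    moreover have "p_subgroup p R"
      unfolding R_def using sylow_of_imp_p_subgroup[OF P] gG by (rule p_subgroup_conj)
    ultimately have "R \<subseteq> P"
      using nor by (intro sylow_of_contains[OF p M P]) (auto simp: N_def normalizes_def)
    then have "g \<in> N"
      using g gG by (auto simp: N_def R_def mem_normalizer_iff[OF PG(1)])
    then show False using g by simp
  qed
  then show ?thesis using nor by simp
qed

end

section \<open>Normal complements in nilpotent groups\<close>

lemma prime_power_dvd_cofactor:
  fixes p q m n :: nat
  assumes "Factorial_Ring.prime p" "Factorial_Ring.prime q" "q \<noteq> p" "m dvd n * p ^ k"
  shows "q ^ multiplicity q m dvd n"
proof -
  have "q ^ multiplicity q m dvd n * p ^ k"
    using multiplicity_dvd assms(4) by (rule dvd_trans)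
  moreover have "coprime (q ^ multiplicity q m) (p ^ k)"
    using assms primes_coprime by auto
  ultimately show ?thesis by (simp add: coprime_dvd_mult_left_iff)
qed

text \<open>Every nonempty fibre is a coset of the kernel.\<close>

lemma (in group_hom) card_vimage:
  assumes fin: "finite (carrier G)" and N: "N \<subseteq> h ` carrier G"
  shows "card {x \<in> carrier G. h x \<in> N} = card N * card (kernel G H h)"
proof -
  have "card {x \<in> {x \<in> carrier G. h x \<in> N}. h x = y} = card (kernel G H h)"
    if y: "y \<in> h ` {x \<in> carrier G. h x \<in> N}" for y
  proof -
    obtain a where a: "a \<in> carrier G" "h a \<in> N" "y = h a" using y by blast
    have "bij_betw (\<lambda>k. k \<otimes>\<^bsub>G\<^esub> a) (kernel G H h) {x \<in> {x \<in> carrier G. h x \<in> N}. h x = y}"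
      using a by (intro bij_betwI[where g = "\<lambda>x. x \<otimes>\<^bsub>G\<^esub> inv\<^bsub>G\<^esub> a"])
        (auto simp: kernel_def G.m_assoc H.r_inv)
    then show ?thesis by (simp add: bij_betw_same_card)
  qed
  then have "card {x \<in> carrier G. h x \<in> N} = card (h ` {x \<in> carrier G. h x \<in> N}) * card (kernel G H h)"
    using fin by (intro card_eq_card_image_mult) auto
  moreover have "h ` {x \<in> carrier G. h x \<in> N} = N" using N by blast
  ultimately show ?thesis by simp
qed

context finite_group
begin

lemma order_pos: "order G > 0"
  using finite_carrier order_gt_0_iff_finite by simp

lemma card_subgroup_dvd_order: "subgroup H G \<Longrightarrow> card H dvd order G"
  using card_subgroup_dvd[OF _ subgroup_self] subgroup.subset unfolding order_def by blast

lemma card_subgroup_eq_order: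
  assumes "subgroup H G" "order G dvd card H"
  shows "H = carrier G"
  using assms card_subgroup_pos[OF assms(1)] card_seteq[OF finite_carrier subgroup.subset[OF assms(1)]]
  by (auto simp: order_def dest: dvd_imp_le)

text \<open>By Lagrange the divisibility makes the index of \<open>N\<close> a divisor of
  \<open>p ^ k\<close>, hence a power of \<open>p\<close>. Later proofs thus only have to compare
  orders.\<close>

lemma q_nilpotentI:
  assumes p: "Factorial_Ring.prime p" and N: "N \<lhd> G" and "coprime (card N) p"
    and dvd: "order G dvd card N * p ^ k"
  shows "q_nilpotent G p"
proof -
  have NG: "subgroup N G" using N by (rule normal_imp_subgroup)
  have "card (rcosets N) * card N dvd p ^ k * card N"
    using dvd lagrange[OF NG] by (simp add: mult.commute)
  then have "card (rcosets N) dvd p ^ k"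
    using card_subgroup_pos[OF NG] by simp
  then show ?thesis
    using assms divides_primepow_nat[OF p] unfolding q_nilpotent_def by blast
qed

lemma sylow_of_subset:
  assumes q: "Factorial_Ring.prime q" and P: "sylow_of q (carrier G) P" and M: "subgroup M G" "P \<subseteq> M"
  shows "sylow_of q M P"
proof -
  have PG: "subgroup P G" "card P = q ^ multiplicity q (order G)"
    using P by (auto simp: sylow_of_def order_def)
  have "card M \<noteq> 0" "\<not> is_unit q" using card_subgroup_pos[OF M(1)] q by auto
  then have "multiplicity q (order G) \<le> multiplicity q (card M)"
    using card_subgroup_dvd[OF PG(1) M] PG(2) by (simp add: multiplicity_geI)
  moreover have "multiplicity q (card M) \<le> multiplicity q (order G)"
    using card_subgroup_dvd_order[OF M(1)] order_pos by (intro dvd_imp_multiplicity_le) auto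
  ultimately show ?thesis using PG M by (simp add: sylow_of_def)
qed

lemma p_dvd_card:
  assumes P: "p_subgroup p P" "P \<noteq> {\<one>}"
  shows "p dvd card P"
proof -
  obtain k where k: "card P = p ^ k" "subgroup P G" using P(1) by (auto simp: p_subgroup_def)
  have "k \<noteq> 0"
  proof
    assume "k = 0"
    then obtain x where "P = {x}" using k card_1_singletonE[of P] by auto
    then show False using P(2) subgroup.one_closed[OF k(2)] by auto
  qed
  then show ?thesis using k by simp
qed

lemma ex_max_card_normal:
  assumes "R {\<one>}"
  shows "\<exists>N. (N \<lhd> G \<and> R N) \<and> (\<forall>N'. N' \<lhd> G \<and> R N' \<longrightarrow> card N' \<le> card N)"
proof (rule ex_has_greatest_nat[where k = "{\<one>}" and b = "Suc (order G)"])
  show "{\<one>} \<lhd> G \<and> R {\<one>}" using assms one_is_normal by simp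
  show "\<forall>N. N \<lhd> G \<and> R N \<longrightarrow> card N < Suc (order G)"
    by (auto simp: less_Suc_eq_le order_pos dest!: normal_imp_subgroup intro: dvd_imp_le card_subgroup_dvd_order)
qed

text \<open>A normal subgroup of maximal order among those of order coprime to \<open>p\<close> contains every
  Sylow \<open>q\<close>-subgroup of \<open>K\<close> with \<open>q \<noteq> p\<close>.\<close>

lemma nilp_normal_imp_q_nilpotent:
  assumes p: "Factorial_Ring.prime p" and K: "K \<lhd> G" and nil: "nilp K"
    and idx: "order G dvd card K * p ^ k"
  shows "q_nilpotent G p"
proof -
  have KG: "subgroup K G" using K by (rule normal_imp_subgroup)
  obtain N where N: "N \<lhd> G" "coprime (card N) p"
    and max: "\<And>N'. N' \<lhd> G \<Longrightarrow> coprime (card N') p \<Longrightarrow> card N' \<le> card N"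
    using ex_max_card_normal[of "\<lambda>N. coprime (card N) p"] by auto
  have NG: "subgroup N G" using N(1) by (rule normal_imp_subgroup)
  have sylow: "q ^ multiplicity q (order G) dvd card N"
    if q: "Factorial_Ring.prime q" and "q \<noteq> p" for q
  proof -
    obtain Q where Q: "sylow_of q K Q" using sylow_of_exists[OF q KG] by blast
    \<comment> \<open>In the nilpotent \<open>K\<close> the subgroup \<open>Q\<close> is normal, and
      normality passes up to \<open>G\<close> because \<open>Q\<close> is Sylow in the normal
      subgroup \<open>K\<close>.\<close>
    have Qn: "Q \<lhd> G"
      using normal_sylow_of_normal[OF q K Q] nilp_sylow_normal[OF q nil KG Q] by blast
    have QG: "subgroup Q G" using Qn by (rule normal_imp_subgroup)
    have "card (N <#> Q) dvd card N * card Q"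
      using card_set_mult[OF NG QG] finite_subgroup NG QG by (metis dvd_triv_left)
    moreover have "coprime (card N * card Q) p"
      using N(2) Q p q \<open>q \<noteq> p\<close> by (auto simp: sylow_of_def primes_coprime)
    ultimately have "coprime (card (N <#> Q)) p"
      by (rule coprime_divisors[OF _ dvd_refl])
    then have "card (N <#> Q) \<le> card N"
      using max normal_set_mult[OF N(1) Qn] by blast
    then have "N = N <#> Q"
      using subset_set_mult[OF NG QG] finite_subgroup normal_imp_subgroup[OF normal_set_mult[OF N(1) Qn]]
      by (intro card_seteq) auto
    then have "card Q dvd card N"
      using subset_set_mult[OF NG QG] card_subgroup_dvd[OF QG NG] by simp
    moreover have "card K \<noteq> 0" "\<not> is_unit q"
      using card_subgroup_pos[OF KG] q by auto
    then have "multiplicity q (order G) \<le> multiplicity q (card K)"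
      using prime_power_dvd_cofactor[OF p q \<open>q \<noteq> p\<close> idx] by (simp add: multiplicity_geI)
    then have "q ^ multiplicity q (order G) dvd card Q"
      using Q by (simp add: sylow_of_def le_imp_power_dvd)
    ultimately show ?thesis by (meson dvd_trans)
  qed
  \<comment> \<open>The extra factor takes care of the prime \<open>p\<close>; all other primes are
    covered by \<open>sylow\<close>.\<close>
  have "order G dvd card N * p ^ multiplicity p (order G)"
  proof (rule dvd_if_prime_powers_dvd)
    fix q :: nat assume "Factorial_Ring.prime q"
    then show "q ^ multiplicity q (order G) dvd card N * p ^ multiplicity p (order G)"
      using sylow by (cases "q = p") (auto intro: dvd_mult2)
  qed (use order_pos card_subgroup_pos[OF NG] p in auto)
  then show ?thesis using q_nilpotentI[OF p N] by blast
qed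

text \<open>Dividing by a normal \<open>p\<close>-complement leaves a nontrivial nilpotent
  \<open>p\<close>-group \<open>B\<close>, and \<open>A\<close> is its abelianization. Two
  successive quotients account for the type of \<open>A\<close>.\<close>

lemma nilpotent_abelian_p_quotient:
  assumes p: "Factorial_Ring.prime p" and "p dvd order G" and nil: "nilpotent_group G"
  shows "\<exists>(A :: 'a set set monoid) \<phi> k. comm_group A \<and> \<phi> \<in> hom G A \<and> \<phi> ` carrier G = carrier A
    \<and> card (carrier A) = p ^ k \<and> k > 0"
proof -
  have "q_nilpotent G p"
    using nilp_normal_imp_q_nilpotent[OF p normal_self, of 0] nil by (simp add: order_def)
  then obtain L k where L: "L \<lhd> G" "coprime (card L) p" "card (rcosets L) = p ^ k"
    unfolding q_nilpotent_def by blast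
  interpret L: normal L G by (rule L(1))
  define B where "B = G Mod L"
  interpret B: group B unfolding B_def by (rule L.factorgroup_is_group)
  interpret f: group_hom G B "\<lambda>x. L #> x"
    unfolding B_def by (intro group_hom.intro group_hom_axioms.intro group_axioms L.factorgroup_is_group L.r_coset_hom_Mod)
  have cB: "card (carrier B) = p ^ k" using L(3) by (simp add: B_def FactGroup_def)
  have finB: "finite (carrier B)" using cB p by (intro card_ge_0_finite) (simp add: prime_gt_0_nat)
  have img: "(\<lambda>x. L #> x) ` carrier G = carrier B" by (simp add: B_def carrier_FactGroup)
  have nilB: "nilpotent_group B" using f.nilpotent_surj_image[OF img nil] .
  have "k \<noteq> 0"
  proof
    assume "k = 0"
    then have "card L = order G" using lagrange[OF L.subgroup_axioms] L(3) by simp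
    then show False using L(2) assms(1,2) by (metis coprime_common_divisor dvd_refl not_prime_unit)
  qed
  define D where "D = derived B (carrier B)"
  have D: "D \<lhd> B" unfolding D_def using B.derived_is_normal[OF B.normal_self] .
  interpret D: normal D B by (rule D)
  have ne: "D \<noteq> carrier B"
  proof
    assume eq: "D = carrier B"
    \<comment> \<open>The first step of the series is the derived subgroup. Were it all of
      \<open>B\<close>, the series would be constant and would reach the identity only for trivial
      \<open>B\<close>.\<close>
    have "lower_central_step B (carrier B) = D"
      unfolding D_def derived_def lower_central_step_def ..
    then have "lower_central_step B (carrier B) = carrier B"
      by (simp only: eq)
    then have "(lower_central_step B ^^ n) (carrier B) = carrier B" for n
      by (induction n) simp_all
    then have "carrier B = {\<one>\<^bsub>B\<^esub>}" using nilB by (auto simp: nilpotent_group_def)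
    then have "p ^ k = 1" using cB by simp
    then show False using \<open>k \<noteq> 0\<close> p by auto
  qed
  define A where "A = B Mod D"
  interpret A: comm_group A unfolding A_def D_def by (rule B.derived_quot_is_comm_group)
  interpret g: group_hom B A "\<lambda>x. D #>\<^bsub>B\<^esub> x"
    unfolding A_def by (intro group_hom.intro group_hom_axioms.intro B.group_axioms D.factorgroup_is_group D.r_coset_hom_Mod)
  have cA: "card (carrier A) * card D = p ^ k"
    using B.lagrange[OF D.subgroup_axioms] cB by (simp add: A_def FactGroup_def order_def)
  then obtain j where j: "card (carrier A) = p ^ j"
    using divides_primepow_nat[OF p] by (metis dvd_triv_left)
  have "j \<noteq> 0"
  proof
    assume "j = 0"
    then have "card D = card (carrier B)" using cA cB j by simp
    then show False using ne card_subset_eq[OF finB D.subset] by simp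
  qed
  moreover have "(\<lambda>x. D #>\<^bsub>B\<^esub> (L #> x)) \<in> hom G A"
    using f.hom_closed g.hom_closed f.hom_mult g.hom_mult by (intro homI) auto
  moreover have "(\<lambda>x. D #>\<^bsub>B\<^esub> (L #> x)) ` carrier G = carrier A"
  proof -
    have "(\<lambda>x. D #>\<^bsub>B\<^esub> (L #> x)) ` carrier G = (\<lambda>x. D #>\<^bsub>B\<^esub> x) ` (\<lambda>x. L #> x) ` carrier G"
      by (rule image_image[symmetric])
    then show ?thesis by (simp only: img A_def carrier_FactGroup)
  qed
  ultimately show ?thesis using j A.comm_group_axioms by blast
qed

section \<open>Transfer\<close>

text \<open>The hypothesis on \<open>P\<close> says that the nontrivial elements of \<open>P\<close> fix no coset of \<open>N\<close> other
  than \<open>N\<close> itself. Hence the right cosets different from \<open>N\<close> fall into regular \<open>P\<close>-orbits, and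
  a transversal \<open>t\<close> with \<open>t (C #> x) = t C \<otimes> x\<close> on them makes all their factors trivial.\<close>

lemma transfer:
  fixes A :: "('c, 'd) monoid_scheme"
  assumes N: "subgroup N G" and A: "comm_group A" and \<phi>: "\<phi> \<in> hom (G\<lparr>carrier := N\<rparr>) A"
    and P: "subgroup P G" "P \<subseteq> N"
    and free: "\<And>g x. g \<in> carrier G \<Longrightarrow> x \<in> P \<Longrightarrow> x \<noteq> \<one> \<Longrightarrow> g \<otimes> x \<otimes> inv g \<in> N \<Longrightarrow> g \<in> N"
  shows "\<exists>V\<in>hom G A. \<forall>x\<in>P. V x = \<phi> x"
proof -
  interpret A: comm_group A by (rule A)
  interpret \<phi>: group_hom "G\<lparr>carrier := N\<rparr>" A \<phi>
    by (intro group_hom.intro group_hom_axioms.intro subgroup_imp_group N A.group_axioms \<phi>)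
  have NG: "x \<in> carrier G" if "x \<in> N" for x by (rule subgroup.mem_carrier[OF N that])
  have PG: "x \<in> carrier G" if "x \<in> P" for x by (rule subgroup.mem_carrier[OF P(1) that])
  have P1: "\<one> \<in> P" by (rule subgroup.one_closed[OF P(1)])
  have sub: "C \<subseteq> carrier G" if "C \<in> rcosets N" for C
    using that subgroup.rcosets_carrier[OF N] group_axioms by blast
  have cl: "C #> g \<in> rcosets N" if "C \<in> rcosets N" "g \<in> carrier G" for C g
    using that subgroup.subset[OF N] by (auto simp: RCOSETS_def coset_mult_assoc)
  have Nx: "N #> x = N" if "x \<in> N" for x using that N NG by (intro coset_join2)
  have Ncos: "N \<in> rcosets N" using N subgroup.subgroup_in_rcosets group_axioms by blast
  \<comment> \<open>If \<open>x\<close> fixes the coset of \<open>g\<close>, then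
    \<open>g \<otimes> x \<otimes> inv g\<close> lies in \<open>N\<close>, so for nontrivial
    \<open>x\<close> the hypothesis \<open>free\<close> puts \<open>g\<close> into
    \<open>N\<close>.\<close>
  have fixed: "x = \<one>" if C: "C \<in> rcosets N" "C \<noteq> N" and x: "x \<in> P" "C #> x = C" for C x
  proof (rule ccontr)
    assume "x \<noteq> \<one>"
    obtain g where g: "g \<in> carrier G" "C = N #> g" using C(1) by (auto simp: RCOSETS_def)
    have "g \<in> N #> g" using g N by (simp add: rcos_self)
    then have "g \<otimes> x \<in> N #> g #> x" unfolding r_coset_def[of G "N #> g" x] by blast
    then obtain n where n: "n \<in> N" "g \<otimes> x = n \<otimes> g" using x g by (auto simp: r_coset_def)
    then have "g \<otimes> x \<otimes> inv g = n" using g PG[OF x(1)] NG by (simp add: m_assoc)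
    then have "g \<in> N" using free[OF g(1) x(1) \<open>x \<noteq> \<one>\<close>] n by simp
    then show False using C(2) g Nx by simp
  qed
  \<comment> \<open>The transversal: \<open>rep\<close> chooses one coset in each
    \<open>P\<close>-orbit, \<open>s\<close> an element of a coset, and \<open>y C\<close> is the
    element of \<open>P\<close> moving \<open>rep C\<close> to \<open>C\<close>. The coset
    \<open>N\<close> is represented by \<open>\<one>\<close>.\<close>
  define orb where "orb = (\<lambda>C. (\<lambda>x. C #> x) ` P)"
  define rep where "rep = (\<lambda>C. SOME D. D \<in> orb C)"
  define y where "y = (\<lambda>C. SOME y. y \<in> P \<and> C = rep C #> y)"
  define s where "s = (\<lambda>D. SOME g. g \<in> (D :: 'a set))"
  define t where "t = (\<lambda>C. if C = N then \<one> else s (rep C) \<otimes> y C)"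
  have orb_eq: "orb (C #> x) = orb C" if C: "C \<in> rcosets N" and x: "x \<in> P" for C x
  proof -
    have "C #> x #> z \<in> orb C" if "z \<in> P" for z
      using that x P PG sub[OF C] by (auto simp: orb_def coset_mult_assoc subgroup.m_closed)
    moreover have "C #> z \<in> orb (C #> x)" if z: "z \<in> P" for z
    proof -
      have "C #> z = C #> x #> (inv x \<otimes> z)" "inv x \<otimes> z \<in> P"
        using z x P PG sub[OF C] by (auto simp: coset_mult_assoc subgroup.m_closed subgroup.m_inv_closed)
      then show ?thesis unfolding orb_def by blast
    qed
    ultimately show ?thesis by (auto simp: orb_def)
  qed
  have rep_eq: "rep (C #> x) = rep C" if "C \<in> rcosets N" "x \<in> P" for C x
    using orb_eq[OF that] by (simp add: rep_def)
  have rep_in: "rep C \<in> orb C" for C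
    unfolding rep_def by (rule someI[of _ "C #> \<one>"]) (use P1 in \<open>auto simp: orb_def\<close>)
  have rep_cos: "rep C \<in> rcosets N" if "C \<in> rcosets N" for C
    using rep_in[of C] cl[OF that] PG by (auto simp: orb_def)
  have y: "y C \<in> P \<and> C = rep C #> y C" if C: "C \<in> rcosets N" for C
  proof -
    obtain x where x: "x \<in> P" "rep C = C #> x" using rep_in[of C] by (auto simp: orb_def)
    then have "C = rep C #> inv x" using PG sub[OF C] by (simp add: coset_mult_assoc)
    moreover have "inv x \<in> P" using x P by (simp add: subgroup.m_inv_closed)
    ultimately have "\<exists>z. z \<in> P \<and> C = rep C #> z" by blast
    then show ?thesis unfolding y_def by (rule someI_ex)
  qed
  have rep_ne: "rep C \<noteq> N" if "C \<in> rcosets N" "C \<noteq> N" for C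
    using y[OF that(1)] that(2) Nx P(2) by auto
  have y_uniq: "z = y C" if C: "C \<in> rcosets N" "C \<noteq> N" and z: "z \<in> P" "C = rep C #> z" for C z
  proof -
    have yP: "y C \<in> P" "rep C #> y C = rep C #> z" using y[OF C(1)] z by auto
    \<comment> \<open>Two elements of \<open>P\<close> moving \<open>rep C\<close> to
      \<open>C\<close> differ by one that fixes \<open>rep C\<close>, which is not \<open>N\<close>;
      that one is trivial by \<open>fixed\<close>.\<close>
    have "rep C #> (z \<otimes> inv (y C)) = rep C #> z #> inv (y C)"
      using z(1) yP(1) PG sub[OF rep_cos[OF C(1)]] by (intro coset_mult_assoc[symmetric]) auto
    also have "\<dots> = rep C #> y C #> inv (y C)"
      using yP by simp
    also have "\<dots> = rep C"
      using PG[OF yP(1)] sub[OF rep_cos[OF C(1)]] by (simp add: coset_mult_assoc)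
    finally have "z \<otimes> inv (y C) = \<one>"
      using z yP P by (intro fixed[OF rep_cos[OF C(1)] rep_ne[OF C]]) (auto simp: subgroup.m_closed subgroup.m_inv_closed)
    then show ?thesis using PG[OF z(1)] PG[OF yP(1)] by (metis inv_closed inv_equality inv_inv)
  qed
  have t_in: "t C \<in> C" if C: "C \<in> rcosets N" for C
  proof (cases "C = N")
    case True
    then show ?thesis using subgroup.one_closed[OF N] by (simp add: t_def)
  next
    case False
    have "s (rep C) \<in> rep C"
      using subgroup.rcosets_non_empty[OF N rep_cos[OF C]] unfolding s_def by (simp add: some_in_eq)
    then have "t C \<in> rep C #> y C" using False by (auto simp: t_def r_coset_def)
    then show ?thesis using y[OF C] by simp
  qed
  have tG: "t C \<in> carrier G" if "C \<in> rcosets N" for C using t_in[OF that] sub[OF that] by blast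
  have tC: "N #> t C = C" if C: "C \<in> rcosets N" for C
  proof -
    obtain g where g: "g \<in> carrier G" "C = N #> g" using C by (auto simp: RCOSETS_def)
    then show ?thesis using t_in[OF C] repr_independence[OF _ g(1) N] by simp
  qed
  have t_mult: "t (C #> x) = t C \<otimes> x" if C: "C \<in> rcosets N" "C \<noteq> N" and x: "x \<in> P" for C x
  proof -
    have xG: "x \<in> carrier G" using x PG by blast
    have Cx: "C #> x \<in> rcosets N" using cl C xG by blast
    have "C #> x #> inv x = C" using xG sub[OF C(1)] by (simp add: coset_mult_assoc)
    moreover have "N #> inv x = N"
      using x P by (intro Nx) (auto simp: subgroup.m_inv_closed)
    ultimately have Cx_ne: "C #> x \<noteq> N" using C(2) by metis
    have yC: "y C \<in> P" "C = rep C #> y C" using y[OF C(1)] by auto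
    have "C #> x = rep C #> (y C \<otimes> x)"
      using yC PG xG sub[OF rep_cos[OF C(1)]] by (metis coset_mult_assoc)
    then have "y C \<otimes> x = y (C #> x)"
      using yC x P rep_eq[OF C(1) x] by (intro y_uniq[OF Cx Cx_ne]) (auto simp: subgroup.m_closed)
    moreover have "s (rep C) \<in> carrier G"
      using subgroup.rcosets_non_empty[OF N rep_cos[OF C(1)]] sub[OF rep_cos[OF C(1)]]
      unfolding s_def by (auto simp: some_in_eq subset_iff)
    ultimately show ?thesis
      using C(2) Cx_ne rep_eq[OF C(1) x] PG yC(1) xG by (simp add: t_def m_assoc)
  qed
  \<comment> \<open>The transfer factors. They lie in \<open>N\<close> and satisfy the cocycle
    identity \<open>c_mult\<close>, which makes the product over all cosets multiplicative.\<close>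
  define c where "c = (\<lambda>g C. t C \<otimes> g \<otimes> inv (t (C #> g)))"
  have c_in: "c g C \<in> N" if C: "C \<in> rcosets N" and g: "g \<in> carrier G" for g C
  proof -
    have "t C \<otimes> g \<in> N #> t (C #> g)"
      using t_in[OF C] tC[OF cl[OF C g]] by (auto simp: r_coset_def)
    then obtain n where "n \<in> N" "t C \<otimes> g = n \<otimes> t (C #> g)" by (auto simp: r_coset_def)
    then show ?thesis using tG[OF cl[OF C g]] NG by (simp add: c_def m_assoc)
  qed
  have c_mult: "c (g \<otimes> h) C = c g C \<otimes> c h (C #> g)"
    if "C \<in> rcosets N" "g \<in> carrier G" "h \<in> carrier G" for g h C
    using that tG cl sub by (simp add: c_def m_assoc coset_mult_assoc)
  define V where "V = (\<lambda>g. finprod A (\<lambda>C. \<phi> (c g C)) (rcosets N))"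
  have \<phi>_cl: "\<phi> x \<in> carrier A" if "x \<in> N" for x using that \<phi>.hom_closed by simp
  have \<phi>_mult: "\<phi> (x \<otimes> z) = \<phi> x \<otimes>\<^bsub>A\<^esub> \<phi> z" if "x \<in> N" "z \<in> N" for x z using that \<phi>.hom_mult by simp
  have "V \<in> hom G A"
  proof (rule homI)
    fix g assume g: "g \<in> carrier G"
    show "V g \<in> carrier A" unfolding V_def using g c_in \<phi>_cl by (intro A.finprod_closed) auto
    fix h assume h: "h \<in> carrier G"
    \<comment> \<open>Multiplication by \<open>g\<close> permutes the cosets, so the second factor
      of the cocycle identity can be reindexed.\<close>
    have inj: "inj_on (\<lambda>C. C #> g) (rcosets N)"
      by (rule inj_on_inverseI[where g = "\<lambda>C. C #> inv g"]) (use g sub in \<open>simp add: coset_mult_assoc\<close>)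
    have img: "(\<lambda>C. C #> g) ` (rcosets N) = rcosets N"
    proof
      show "(\<lambda>C. C #> g) ` (rcosets N) \<subseteq> rcosets N" using cl g by blast
      show "rcosets N \<subseteq> (\<lambda>C. C #> g) ` (rcosets N)"
      proof
        fix C assume C: "C \<in> rcosets N"
        have "C = C #> inv g #> g" using g sub[OF C] by (simp add: coset_mult_assoc)
        then show "C \<in> (\<lambda>C. C #> g) ` (rcosets N)" using cl[OF C inv_closed[OF g]] by blast
      qed
    qed
    have "V (g \<otimes> h) = finprod A (\<lambda>C. \<phi> (c g C) \<otimes>\<^bsub>A\<^esub> \<phi> (c h (C #> g))) (rcosets N)"
      unfolding V_def using g h c_in cl c_mult \<phi>_mult \<phi>_cl by (intro A.finprod_cong') auto
    also have "\<dots> = V g \<otimes>\<^bsub>A\<^esub> finprod A (\<lambda>C. \<phi> (c h (C #> g))) (rcosets N)"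
      unfolding V_def using g h c_in cl \<phi>_cl by (intro A.finprod_multf) auto
    also have "finprod A (\<lambda>C. \<phi> (c h (C #> g))) (rcosets N) = V h"
      using A.finprod_reindex[of "\<lambda>C. \<phi> (c h C)" "\<lambda>C. C #> g" "rcosets N"] inj img c_in h \<phi>_cl
      by (auto simp: V_def)
    finally show "V (g \<otimes> h) = V g \<otimes>\<^bsub>A\<^esub> V h" .
  qed
  moreover have "V x = \<phi> x" if x: "x \<in> P" for x
  proof -
    have xN: "x \<in> N" using x P by blast
    have "finite (rcosets N)"
      using finite_carrier rcosets_subset_PowG[OF N] finite_subset by blast
    \<comment> \<open>Only the coset \<open>N\<close> contributes: it is fixed by \<open>x\<close>
      and has representative \<open>\<one>\<close>, so its factor is \<open>x\<close>. Elsewhere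
      \<open>t_mult\<close> makes the factor trivial.\<close>
    have "\<phi> (c x C) = (if N = C then \<phi> x else \<one>\<^bsub>A\<^esub>)" if C: "C \<in> rcosets N" for C
    proof (cases "C = N")
      case True
      then show ?thesis using xN NG Nx by (simp add: c_def t_def)
    next
      case False
      then have "c x C = \<one>"
        using t_mult[OF C False x] tG[OF C] PG[OF x] by (simp add: c_def)
      then show ?thesis using False \<phi>.hom_one by simp
    qed
    then have "V x = finprod A (\<lambda>C. if N = C then \<phi> x else \<one>\<^bsub>A\<^esub>) (rcosets N)"
      unfolding V_def using \<phi>_cl[OF xN] by (intro A.finprod_cong') auto
    also have "\<dots> = \<phi> x"
      using A.finprod_singleton[OF Ncos \<open>finite (rcosets N)\<close>, of "\<lambda>_. \<phi> x"] \<phi>_cl[OF xN] by simp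
    finally show ?thesis .
  qed
  ultimately show ?thesis by blast
qed

end

section \<open>Groups without normal \<open>p\<close>-subgroups\<close>

text \<open>Instantiated twice: for \<open>G\<close> and \<open>p\<close> when the largest normal
  \<open>p\<close>-subgroup is trivial, and for a quotient with another prime \<open>q\<close> in
  the role of \<open>p\<close>.\<close>

locale nilpotent_p_locals = finite_group +
  fixes p :: nat
  assumes prime_p: "Factorial_Ring.prime p"
    and p_dvd: "p dvd order G"
    and nilp_proper: "\<And>M. subgroup M G \<Longrightarrow> M \<noteq> carrier G \<Longrightarrow> p dvd card M \<Longrightarrow> nilp M"
    and no_normal_p: "\<And>N. N \<lhd> G \<Longrightarrow> p_subgroup p N \<Longrightarrow> N = {\<one>}"
begin

text \<open>By \<open>no_normal_p\<close> the normalizer is proper, and its order is divisible by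
  \<open>p\<close> because it contains \<open>P\<close>.\<close>

lemma nilp_normalizer:
  assumes P: "p_subgroup p P" "P \<noteq> {\<one>}"
  shows "nilp (normalizer G P)"
proof -
  have PG: "subgroup P G" using P by (simp add: p_subgroup_def)
  have "normalizer G P \<noteq> carrier G"
    using P no_normal_p normal_iff_normalizer_eq[OF PG] by blast
  moreover have "p dvd card (normalizer G P)"
    using p_dvd_card[OF P] card_subgroup_dvd[OF PG subgroup_normalizer[OF PG] subset_normalizer[OF PG]]
    by (rule dvd_trans)
  ultimately show ?thesis
    using nilp_proper subgroup_normalizer[OF PG] by blast
qed

text \<open>Maximality by inclusion rather than by order, so that any \<open>p\<close>-subgroup
  extends to such a \<open>P\<close> by finiteness alone.\<close>

definition max_p_subgroup :: "'a set \<Rightarrow> bool" where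
  "max_p_subgroup P \<longleftrightarrow> p_subgroup p P \<and> (\<forall>R. p_subgroup p R \<longrightarrow> P \<subseteq> R \<longrightarrow> R = P)"

lemma ex_max_p_subgroup:
  assumes "p_subgroup p R"
  shows "\<exists>P. max_p_subgroup P \<and> R \<subseteq> P"
proof -
  have "\<exists>P. (p_subgroup p P \<and> R \<subseteq> P) \<and> (\<forall>P'. p_subgroup p P' \<and> R \<subseteq> P' \<longrightarrow> card P' \<le> card P)"
  proof (rule ex_has_greatest_nat[where k = R and b = "Suc (order G)"])
    show "\<forall>P. p_subgroup p P \<and> R \<subseteq> P \<longrightarrow> card P < Suc (order G)"
      by (auto simp: less_Suc_eq_le order_pos p_subgroup_def intro: dvd_imp_le card_subgroup_dvd_order)
  qed (use assms in auto)
  then obtain P where P: "p_subgroup p P" "R \<subseteq> P"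
    and max: "\<And>P'. p_subgroup p P' \<Longrightarrow> R \<subseteq> P' \<Longrightarrow> card P' \<le> card P" by blast
  have "P' = P" if "p_subgroup p P'" "P \<subseteq> P'" for P'
  proof -
    have "finite P'" using that finite_subgroup by (simp add: p_subgroup_def)
    moreover have "card P' \<le> card P" using max that P(2) by blast
    ultimately show ?thesis using card_seteq that(2) by blast
  qed
  then show ?thesis using P unfolding max_p_subgroup_def by blast
qed

text \<open>If the intersection \<open>D\<close> of two distinct maximal \<open>p\<close>-subgroups were nontrivial and as large
  as possible, then both would meet the unique Sylow subgroup of the nilpotent group
  \<open>normalizer G D\<close> in more than \<open>D\<close>, hence both would equal the maximal \<open>p\<close>-subgroup above it.\<close>

lemma max_p_subgroup_inter_trivial:
  assumes "max_p_subgroup P" "max_p_subgroup R" "P \<inter> R \<noteq> {\<one>}"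
  shows "P = R"
  using assms
\<comment> \<open>The measure decreases as the intersection grows, so pairs with a larger
  intersection are settled first.\<close>
proof (induction "order G - card (P \<inter> R)" arbitrary: P R rule: less_induct)
  case less
  define D where "D = P \<inter> R"
  have PR: "p_subgroup p P" "p_subgroup p R" "subgroup P G" "subgroup R G"
    using less.prems by (auto simp: max_p_subgroup_def p_subgroup_def)
  have DG: "subgroup D G" unfolding D_def using PR by (intro subgroups_Inter_pair)
  have Dp: "p_subgroup p D" "D \<noteq> {\<one>}"
    using p_subgroup_subgroup[OF prime_p PR(1) DG] less.prems by (auto simp: D_def)
  define N where "N = normalizer G D"
  have NG: "subgroup N G" unfolding N_def using DG by (rule subgroup_normalizer)
  have nilN: "nilp N" unfolding N_def using Dp by (rule nilp_normalizer)
  obtain S where S: "sylow_of p N S" using sylow_of_exists[OF prime_p NG] by blast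
  obtain T where T: "max_p_subgroup T" "S \<subseteq> T"
    using ex_max_p_subgroup sylow_of_imp_p_subgroup[OF S] by blast
  \<comment> \<open>To be applied to both \<open>P\<close> and \<open>R\<close>. Since
    \<open>Q\<close> is nilpotent, some element of \<open>Q\<close> outside \<open>D\<close>
    normalizes \<open>D\<close>; it lies in \<open>S\<close>, hence in \<open>T\<close>. So
    \<open>Q\<close> meets \<open>T\<close> in more than \<open>D\<close>, and induction
    applies.\<close>
  have step: "Q = T" if Q: "max_p_subgroup Q" "D \<subseteq> Q" "D \<noteq> Q" for Q
  proof -
    have Qp: "p_subgroup p Q" "subgroup Q G" using Q by (auto simp: max_p_subgroup_def p_subgroup_def)
    have "Q \<noteq> {\<one>}" using Q Dp(2) subgroup.one_closed[OF DG] by auto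
    have "nilp Q"
      using nilp_subset[OF nilp_normalizer[OF Qp(1) \<open>Q \<noteq> {\<one>}\<close>] subgroup_normalizer[OF Qp(2)] Qp(2) subset_normalizer[OF Qp(2)]] .
    then obtain g where g: "g \<in> Q" "g \<notin> D" "\<forall>h\<in>D. g \<otimes> h \<otimes> inv g \<in> D"
      using nilp_normalizer_grows[OF _ Qp(2) DG Q(2,3)] by blast
    have gN: "g \<in> N"
      using g subgroup.mem_carrier[OF Qp(2)] by (simp add: N_def mem_normalizer_iff[OF DG])
    have QN: "subgroup (Q \<inter> N) G" using Qp NG by (intro subgroups_Inter_pair)
    have "Q \<inter> N \<subseteq> S"
      using p_subgroup_subgroup[OF prime_p Qp(1) QN] nilp_sylow_normal[OF prime_p nilN NG S]
      by (intro sylow_of_normal_contains[OF prime_p NG S]) auto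
    then have "insert g D \<subseteq> Q \<inter> T"
      using T g gN Q(2) subset_normalizer[OF DG] by (auto simp: N_def)
    moreover have QT: "subgroup (Q \<inter> T) G"
      using Qp T by (intro subgroups_Inter_pair) (auto simp: max_p_subgroup_def p_subgroup_def)
    ultimately have "card D < card (Q \<inter> T)"
      using g(2) finite_subgroup by (intro psubset_card_mono) auto
    moreover have "card (Q \<inter> T) \<le> order G"
      using card_subgroup_dvd_order[OF QT] order_pos by (simp add: dvd_imp_le)
    ultimately have "order G - card (Q \<inter> T) < order G - card (P \<inter> R)"
      by (simp add: D_def)
    moreover have "g \<noteq> \<one>" using g(2) subgroup.one_closed[OF DG] by auto
    then have "Q \<inter> T \<noteq> {\<one>}"
      using \<open>insert g D \<subseteq> Q \<inter> T\<close> by blast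
    ultimately show ?thesis using less.hyps Q(1) T(1) by blast
  qed
  show ?case
  \<comment> \<open>If \<open>D\<close> is one of the two subgroups, it lies in the other and
    maximality gives equality.\<close>
  proof (cases "D = P \<or> D = R")
    case True
    then show ?thesis
      using less.prems PR unfolding max_p_subgroup_def D_def by (metis inf.orderI inf_commute)
  next
    case False
    then show ?thesis using step less.prems by (metis D_def inf_le1 inf_le2)
  qed
qed

lemma max_p_subgroup_sylow:
  assumes "sylow_of p (carrier G) P"
  shows "max_p_subgroup P"
  using sylow_of_maximal[OF prime_p subgroup_self assms] sylow_of_imp_p_subgroup[OF assms] subgroup.subset
  unfolding max_p_subgroup_def p_subgroup_def by blast

lemma sylow_nontrivial:
  assumes "sylow_of p (carrier G) P"
  shows "P \<noteq> {\<one>}"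
proof
  assume "P = {\<one>}"
  then have "p ^ multiplicity p (order G) = 1" using assms by (simp add: sylow_of_def order_def)
  moreover have "multiplicity p (order G) > 0"
    using p_dvd prime_p order_pos by (simp add: prime_multiplicity_gt_zero_iff)
  ultimately show False using prime_p by auto
qed

text \<open>The complement is the kernel of the transfer \<open>V\<close> into an abelian
  \<open>p\<close>-quotient of the normalizer \<open>N\<close> of \<open>P\<close>. Its index
  divides the order of that quotient.\<close>

lemma normal_p_complement:
  "\<exists>K k. K \<lhd> G \<and> coprime (card K) p \<and> order G dvd card K * p ^ k"
proof -
  obtain P where P: "sylow_of p (carrier G) P"
    using sylow_of_exists[OF prime_p subgroup_self] by blast
  have PG: "subgroup P G" and Pp: "p_subgroup p P"
    using P sylow_of_imp_p_subgroup by (auto simp: sylow_of_def)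
  note P1 = sylow_nontrivial[OF P]
  define N where "N = normalizer G P"
  have NG: "subgroup N G" unfolding N_def using PG by (rule subgroup_normalizer)
  have PN: "P \<subseteq> N" unfolding N_def using PG by (rule subset_normalizer)
  have nilN: "nilp N" unfolding N_def using Pp P1 by (rule nilp_normalizer)
  interpret N: finite_group "G\<lparr>carrier := N\<rparr>" using NG by (rule finite_group_restrict)
  have "p dvd order (G\<lparr>carrier := N\<rparr>)"
    using p_dvd_card[OF Pp P1] card_subgroup_dvd[OF PG NG PN] by (auto simp: order_def dest: dvd_trans)
  then obtain A :: "'a set set monoid" and \<phi> k where A: "comm_group A" "\<phi> \<in> hom (G\<lparr>carrier := N\<rparr>) A"
      "\<phi> ` N = carrier A" "card (carrier A) = p ^ k" "k > 0"
    using N.nilpotent_abelian_p_quotient[OF prime_p _ nilN] by auto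
  interpret A: comm_group A by (rule A(1))
  interpret \<phi>: group_hom "G\<lparr>carrier := N\<rparr>" A \<phi>
    by (intro group_hom.intro group_hom_axioms.intro N.group_axioms A.group_axioms A(2))
  \<comment> \<open>All \<open>p\<close>-subgroups of \<open>N\<close> lie in \<open>P\<close>, so
    the conjugate of \<open>x\<close> is a common nontrivial element of \<open>P\<close> and its
    conjugate \<open>R\<close>. Then \<open>P = R\<close>, and \<open>g\<close> normalizes
    \<open>P\<close>.\<close>
  have free: "g \<in> N" if g: "g \<in> carrier G" and x: "x \<in> P" "x \<noteq> \<one>" "g \<otimes> x \<otimes> inv g \<in> N" for g x
  proof -
    define R where "R = (\<lambda>x. g \<otimes> x \<otimes> inv g) ` P"
    have Rs: "sylow_of p (carrier G) R"
      unfolding R_def using sylow_of_conj[OF normal_self P g] .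
    have RG: "subgroup R G" using Rs by (simp add: sylow_of_def)
    have RN: "subgroup (R \<inter> N) G" using RG NG by (intro subgroups_Inter_pair)
    have "R \<inter> N \<subseteq> P"
      using p_subgroup_subgroup[OF prime_p sylow_of_imp_p_subgroup[OF Rs] RN] normalizes_normalizer[OF PG]
      by (intro sylow_of_contains[OF prime_p NG sylow_of_subset[OF prime_p P NG PN]])
        (auto simp: N_def normalizes_def)
    then have "g \<otimes> x \<otimes> inv g \<in> P \<inter> R" using x by (auto simp: R_def)
    moreover have "g \<otimes> x \<otimes> inv g \<noteq> \<one>"
      using x g subgroup.mem_carrier[OF PG] by (simp add: conj_eq_iff)
    ultimately have "P \<inter> R \<noteq> {\<one>}" by auto
    then have "P = R"
      using max_p_subgroup_inter_trivial max_p_subgroup_sylow P Rs by blast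
    then show ?thesis
      using g by (auto simp: N_def mem_normalizer_iff[OF PG] R_def)
  qed
  obtain V where V: "V \<in> hom G A" "\<forall>x\<in>P. V x = \<phi> x"
    using transfer[OF NG A(1,2) PG PN] free by blast
  interpret V: group_hom G A V
    by (intro group_hom.intro group_hom_axioms.intro group_axioms A.group_axioms V(1))
  define K where "K = kernel G A V"
  have K: "K \<lhd> G" unfolding K_def by (rule V.normal_kernel)
  have KG: "subgroup K G" using K by (rule normal_imp_subgroup)
  have "card {x \<in> carrier G. V x \<in> V ` carrier G} = card (V ` carrier G) * card K"
    unfolding K_def by (rule V.card_vimage[OF finite_carrier]) simp
  moreover have "{x \<in> carrier G. V x \<in> V ` carrier G} = carrier G" by blast
  ultimately have ordG: "order G = card (V ` carrier G) * card K" by (simp add: order_def)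
  have "card (V ` carrier G) dvd p ^ k"
    using A.lagrange[OF V.subgroup_img_is_subgroup[OF subgroup_self]] A(4)
    by (metis dvd_triv_right order_def)
  then have dvd: "order G dvd card K * p ^ k"
    by (simp add: ordG mult.commute mult_dvd_mono)
  \<comment> \<open>Otherwise \<open>P\<close> lies in the kernel of \<open>\<phi>\<close>, whose
    index in \<open>N\<close> is \<open>p ^ k\<close> with \<open>k > 0\<close>. Then
    \<open>p * card P\<close> divides the order of \<open>G\<close>, against the choice of
    \<open>P\<close> as Sylow subgroup.\<close>
  have "K \<noteq> carrier G"
  proof
    assume "K = carrier G"
    then have "\<phi> x = \<one>\<^bsub>A\<^esub>" if "x \<in> P" for x
      using V(2) that subgroup.mem_carrier[OF PG that] by (auto simp: K_def kernel_def)
    then have Pker: "P \<subseteq> kernel (G\<lparr>carrier := N\<rparr>) A \<phi>"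
      using PN by (auto simp: kernel_def)
    have ker: "subgroup (kernel (G\<lparr>carrier := N\<rparr>) A \<phi>) G"
      using incl_subgroup[OF NG \<phi>.subgroup_kernel] .
    have "card {x \<in> N. \<phi> x \<in> carrier A} = card (carrier A) * card (kernel (G\<lparr>carrier := N\<rparr>) A \<phi>)"
      using \<phi>.card_vimage[of "carrier A"] finite_subgroup[OF NG] A(3) by simp
    moreover have "{x \<in> N. \<phi> x \<in> carrier A} = N" using A(3) by blast
    ultimately have "card N = p ^ k * card (kernel (G\<lparr>carrier := N\<rparr>) A \<phi>)"
      using A(4) by simp
    then have "p * card P dvd card N"
      using card_subgroup_dvd[OF PG ker Pker] A(5) by (auto intro!: mult_dvd_mono)
    then have "p * card P dvd order G"
      using card_subgroup_dvd_order[OF NG] by (rule dvd_trans)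
    then have "p ^ Suc (multiplicity p (order G)) dvd order G"
      using P by (simp add: sylow_of_def order_def)
    moreover have "order G \<noteq> 0" "\<not> is_unit p" using order_pos prime_p by auto
    ultimately show False
      using multiplicity_geI[where p = p and x = "order G" and n = "Suc (multiplicity p (order G))"] by simp
  qed
  \<comment> \<open>Otherwise the proper subgroup \<open>K\<close> is nilpotent, and its Sylow
    \<open>p\<close>-subgroup is a nontrivial normal \<open>p\<close>-subgroup of
    \<open>G\<close>.\<close>
  have "\<not> p dvd card K"
  proof
    assume pK: "p dvd card K"
    have nilK: "nilp K" using nilp_proper KG \<open>K \<noteq> carrier G\<close> pK by blast
    obtain S where S: "sylow_of p K S" using sylow_of_exists[OF prime_p KG] by blast
    have "S \<lhd> G"
      using normal_sylow_of_normal[OF prime_p K S nilp_sylow_normal[OF prime_p nilK KG S]] .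
    then have "S = {\<one>}" using no_normal_p sylow_of_imp_p_subgroup[OF S] by blast
    then have "p ^ multiplicity p (card K) = 1" using S by (simp add: sylow_of_def)
    moreover have "multiplicity p (card K) > 0"
      using pK prime_p card_subgroup_pos[OF KG] by (simp add: prime_multiplicity_gt_zero_iff)
    ultimately show False using prime_p by auto
  qed
  then have "coprime (card K) p"
    using prime_p by (metis coprime_commute prime_imp_coprime)
  then show ?thesis using K dvd by blast
qed

lemma q_nilpotent_p: "q_nilpotent G p"
  using normal_p_complement q_nilpotentI[OF prime_p] by blast

text \<open>Failure for the single prime \<open>q0\<close> already forces, for every prime
  \<open>q\<close> other than \<open>p\<close>, the full \<open>q\<close>-part of the order of
  \<open>G\<close> into the normalizer \<open>N\<close> of \<open>P\<close>. Then \<open>N\<close>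
  is all of \<open>G\<close>, and \<open>P\<close> is a nontrivial normal
  \<open>p\<close>-subgroup.\<close>

lemma q_closed_q:
  assumes q0: "Factorial_Ring.prime q0" "q0 dvd order G" "q0 \<noteq> p"
  shows "q_closed G q0"
proof (rule ccontr)
  assume not_closed: "\<not> q_closed G q0"
  obtain K k where K: "K \<lhd> G" "coprime (card K) p" "order G dvd card K * p ^ k"
    using normal_p_complement by blast
  have KG: "subgroup K G" using K(1) by (rule normal_imp_subgroup)
  obtain P where P: "sylow_of p (carrier G) P"
    using sylow_of_exists[OF prime_p subgroup_self] by blast
  have PG: "subgroup P G" and Pp: "p_subgroup p P"
    using P sylow_of_imp_p_subgroup by (auto simp: sylow_of_def)
  define N where "N = normalizer G P"
  have NG: "subgroup N G" unfolding N_def using PG by (rule subgroup_normalizer)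
  have PN: "P \<subseteq> N" unfolding N_def using PG by (rule subset_normalizer)
  have other: "q ^ multiplicity q (order G) dvd card N"
    if q: "Factorial_Ring.prime q" "q \<noteq> p" for q
  proof -
    obtain Q where Q: "sylow_of q K Q" using sylow_of_exists[OF q(1) KG] by blast
    have QG: "subgroup Q G" "Q \<subseteq> K" using Q by (auto simp: sylow_of_def)
    have "card K \<noteq> 0" "\<not> is_unit q" using card_subgroup_pos[OF KG] q by auto
    then have "multiplicity q (order G) \<le> multiplicity q (card K)"
      using prime_power_dvd_cofactor[OF prime_p q K(3)] by (simp add: multiplicity_geI)
    moreover have "multiplicity q (card K) \<le> multiplicity q (order G)"
      using card_subgroup_dvd_order[OF KG] order_pos by (intro dvd_imp_multiplicity_le) auto
    ultimately have cQ: "card Q = q ^ multiplicity q (order G)"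
      using Q by (simp add: sylow_of_def)
    define M where "M = normalizer G Q"
    have MG: "subgroup M G" unfolding M_def using QG(1) by (rule subgroup_normalizer)
    obtain R where R: "sylow_of p M R" using sylow_of_exists[OF prime_p MG] by blast
    have RG: "subgroup R G" "R \<subseteq> M" using R by (auto simp: sylow_of_def)
    \<comment> \<open>As \<open>card K\<close> is prime to \<open>p\<close>, the Frattini argument
      puts the full \<open>p\<close>-part of the order into the normalizer \<open>M\<close> of
      \<open>Q\<close>; thus \<open>R\<close> is Sylow in \<open>G\<close>.\<close>
    have "p ^ multiplicity p (order G) dvd card K * card M"
      using dvd_trans[OF multiplicity_dvd frattini[OF q(1) K(1) Q]] by (simp add: M_def)
    then have "p ^ multiplicity p (order G) dvd card M"
      using K(2) by (simp add: coprime_commute coprime_dvd_mult_right_iff)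
    moreover have "card M \<noteq> 0" "\<not> is_unit p" using card_subgroup_pos[OF MG] prime_p by auto
    ultimately have "multiplicity p (order G) \<le> multiplicity p (card M)"
      by (simp add: multiplicity_geI)
    moreover have "multiplicity p (card M) \<le> multiplicity p (order G)"
      using card_subgroup_dvd_order[OF MG] order_pos by (intro dvd_imp_multiplicity_le) auto
    ultimately have Rs: "sylow_of p (carrier G) R"
      using R RG subgroup.subset by (auto simp: sylow_of_def order_def)
    have RQ: "normalizes R Q"
      using RG normalizes_normalizer[OF QG(1)] by (auto simp: M_def normalizes_def)
    define H where "H = Q <#> R"
    have HG: "subgroup H G" unfolding H_def using subgroup_set_mult[OF QG(1) RG(1) RQ] .
    have sub: "Q \<subseteq> H" "R \<subseteq> H" unfolding H_def using subset_set_mult[OF QG(1) RG(1)] .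
    \<comment> \<open>For \<open>q = q0\<close>, equality would make \<open>Q\<close> normal, since
      \<open>H\<close> lies in \<open>M\<close>. For other \<open>q\<close> the order of
      \<open>G\<close> would involve only the primes \<open>q\<close> and \<open>p\<close>, although
      \<open>q0\<close> divides it.\<close>
    have "H \<noteq> carrier G"
    proof
      assume HeqG: "H = carrier G"
      show False
      proof (cases "q = q0")
        case True
        have "H \<subseteq> M"
          unfolding H_def using set_mult_subset[OF MG _ RG(2)] subset_normalizer[OF QG(1)] by (simp add: M_def)
        then have "Q \<lhd> G"
          using HeqG subgroup.subset[OF MG] normal_iff_normalizer_eq[OF QG(1)] by (auto simp: M_def)
        then show False using not_closed QG(1) cQ True by (auto simp: q_closed_def)
      next
        case False
        have "order G dvd card Q * card R"
          using card_set_mult[OF QG(1) RG(1)] finite_subgroup QG RG HeqG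
          by (metis H_def dvd_triv_left order_def)
        then have "q0 dvd q ^ multiplicity q (order G) * p ^ multiplicity p (order G)"
          using q0(2) cQ Rs by (auto simp: sylow_of_def order_def dest: dvd_trans)
        then have "q0 dvd q \<or> q0 dvd p"
          using q0(1) by (auto simp: prime_dvd_mult_iff dest: prime_dvd_power)
        then show False
          using q0 q prime_p False by (metis primes_dvd_imp_eq)
      qed
    qed
    moreover have "p dvd card H"
      using p_dvd_card[OF sylow_of_imp_p_subgroup[OF Rs] sylow_nontrivial[OF Rs]]
        card_subgroup_dvd[OF RG(1) HG sub(2)] by (rule dvd_trans)
    ultimately have "nilp H" using nilp_proper HG by blast
    then have "normalizes H R"
      using nilp_sylow_normal[OF prime_p _ HG sylow_of_subset[OF prime_p Rs HG sub(2)]] by blast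
    then have QR: "normalizes Q R" using sub by (auto simp: normalizes_def)
    obtain g where g: "g \<in> carrier G" "\<forall>r\<in>R. g \<otimes> r \<otimes> inv g \<in> P"
      using sylow_conj[OF prime_p subgroup_self P sylow_of_imp_p_subgroup[OF Rs] subgroup.subset[OF RG(1)]] by blast
    have "(\<lambda>x. g \<otimes> x \<otimes> inv g) ` R \<subseteq> P" using g by blast
    \<comment> \<open>Since \<open>Q\<close> normalizes \<open>R\<close>, the conjugate of
      \<open>Q\<close> by the element \<open>g\<close> that carries \<open>R\<close> onto
      \<open>P\<close> normalizes \<open>P\<close>.\<close>
    then have img: "(\<lambda>x. g \<otimes> x \<otimes> inv g) ` R = P"
      using card_conj[OF RG(1) g(1)] P Rs finite_subgroup[OF PG] by (intro card_subset_eq) (auto simp: sylow_of_def)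
    have QG': "subgroup ((\<lambda>x. g \<otimes> x \<otimes> inv g) ` Q) G" using subgroup_conj[OF QG(1) g(1)] .
    have "(\<lambda>x. g \<otimes> x \<otimes> inv g) ` Q \<subseteq> N"
    proof
      fix z assume "z \<in> (\<lambda>x. g \<otimes> x \<otimes> inv g) ` Q"
      then obtain x where x: "x \<in> Q" "z = g \<otimes> x \<otimes> inv g" by blast
      have xG: "x \<in> carrier G" using subgroup.mem_carrier[OF QG(1) x(1)] .
      have "z \<otimes> h \<otimes> inv z \<in> P" if h: "h \<in> P" for h
      proof -
        obtain r where r: "r \<in> R" "h = g \<otimes> r \<otimes> inv g" using h img by blast
        have rG: "r \<in> carrier G" using subgroup.mem_carrier[OF RG(1) r(1)] .
        have "z \<otimes> h \<otimes> inv z = g \<otimes> (x \<otimes> r \<otimes> inv x) \<otimes> inv g"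
          using g(1) xG rG x(2) r(2) by (simp add: m_assoc inv_mult_group)
        then show ?thesis using QR x r g(2) by (auto simp: normalizes_def)
      qed
      then show "z \<in> N" using x xG g(1) by (simp add: N_def mem_normalizer_iff[OF PG])
    qed
    from card_subgroup_dvd[OF QG' NG this] show ?thesis
      by (simp add: card_conj[OF QG(1) g(1)] cQ)
  qed
  have "order G dvd card N"
  proof (rule dvd_if_prime_powers_dvd)
    fix q :: nat assume "Factorial_Ring.prime q"
    then show "q ^ multiplicity q (order G) dvd card N"
      using other card_subgroup_dvd[OF PG NG PN] P by (cases "q = p") (auto simp: sylow_of_def order_def)
  qed (use order_pos card_subgroup_pos[OF NG] in auto)
  then have "P \<lhd> G"
    using card_subgroup_eq_order[OF NG] normal_iff_normalizer_eq[OF PG] by (simp add: N_def)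
  then show False using no_normal_p Pp sylow_nontrivial[OF P] by blast
qed

end

section \<open>Passage to quotients\<close>

context finite_group
begin

lemma group_hom_Mod: "U \<lhd> G \<Longrightarrow> group_hom G (G Mod U) (\<lambda>x. U #> x)"
  by (intro group_hom.intro group_hom_axioms.intro group_axioms normal.factorgroup_is_group normal.r_coset_hom_Mod)

lemma kernel_Mod: "U \<lhd> G \<Longrightarrow> kernel G (G Mod U) (\<lambda>x. U #> x) = U"
  using coset_join1[of U] coset_join2[of _ U] normal_imp_subgroup[of U G] subgroup.subset[of U G]
  by (auto simp: kernel_def)

lemma image_Mod: "(\<lambda>x. U #> x) ` carrier G = carrier (G Mod U)"
  by (simp add: carrier_FactGroup)

lemma finite_group_Mod:
  assumes "U \<lhd> G"
  shows "finite_group (G Mod U)"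
  using normal.factorgroup_is_group[OF assms] finite_carrier
  by (simp add: finite_group_def finite_group_axioms_def image_Mod[symmetric])

lemma order_Mod:
  assumes "U \<lhd> G"
  shows "order G = order (G Mod U) * card U"
  using lagrange[OF normal_imp_subgroup[OF assms]] by (simp add: order_def FactGroup_def)

text \<open>The lifting half of the correspondence between subgroups of the quotient and subgroups
  containing \<open>U\<close>.\<close>

lemma subgroup_vimage_Mod:
  assumes U: "U \<lhd> G" and M: "subgroup M (G Mod U)"
  shows "subgroup {x \<in> carrier G. U #> x \<in> M} G" "U \<subseteq> {x \<in> carrier G. U #> x \<in> M}"
    and "card {x \<in> carrier G. U #> x \<in> M} = card M * card U"
    and "(\<lambda>x. U #> x) ` {x \<in> carrier G. U #> x \<in> M} = M"
proof -
  interpret f: group_hom G "G Mod U" "\<lambda>x. U #> x" using U by (rule group_hom_Mod)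
  have XG: "subgroup U G" using U by (rule normal_imp_subgroup)
  have M1: "U \<in> M" using subgroup.one_closed[OF M] by simp
  show "subgroup {x \<in> carrier G. U #> x \<in> M} G"
  proof (rule subgroupI)
    show "{x \<in> carrier G. U #> x \<in> M} \<noteq> {}"
      using M1 coset_mult_one[OF subgroup.subset[OF XG]] by force
  qed (use f.hom_mult f.hom_inv subgroup.m_closed[OF M] subgroup.m_inv_closed[OF M] in auto)
  show "U \<subseteq> {x \<in> carrier G. U #> x \<in> M}"
    using M1 coset_join2[OF _ XG] subgroup.subset[OF XG] by auto
  have sub: "M \<subseteq> (\<lambda>x. U #> x) ` carrier G"
    using subgroup.subset[OF M] by (simp add: image_Mod)
  show "card {x \<in> carrier G. U #> x \<in> M} = card M * card U"
    using f.card_vimage[OF finite_carrier sub] by (simp add: kernel_Mod[OF U])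
  show "(\<lambda>x. U #> x) ` {x \<in> carrier G. U #> x \<in> M} = M"
    using sub by blast
qed

lemma normal_vimage_Mod:
  assumes U: "U \<lhd> G" and N: "N \<lhd> G Mod U"
  shows "{x \<in> carrier G. U #> x \<in> N} \<lhd> G"
proof -
  interpret f: group_hom G "G Mod U" "\<lambda>x. U #> x" using U by (rule group_hom_Mod)
  have "U #> (g \<otimes> x \<otimes> inv g) \<in> N" if "g \<in> carrier G" "x \<in> carrier G" "U #> x \<in> N" for g x
    using that f.hom_mult f.hom_inv f.hom_closed normal.inv_op_closed2[OF N] by simp
  then show ?thesis
    using subgroup_vimage_Mod(1)[OF U normal_imp_subgroup[OF N]] by (auto simp: normal_inv_iff)
qed

text \<open>The preimage of \<open>M\<close> is a proper subgroup containing \<open>U\<close>, hence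
  nilpotent, and maps onto \<open>M\<close>.\<close>

lemma nilp_Mod:
  assumes U: "U \<lhd> G"
    and nil: "\<And>M. subgroup M G \<Longrightarrow> U \<subseteq> M \<Longrightarrow> M \<noteq> carrier G \<Longrightarrow> nilp M"
    and M: "subgroup M (G Mod U)" "M \<noteq> carrier (G Mod U)"
  shows "nilpotent_group ((G Mod U)\<lparr>carrier := M\<rparr>)"
proof -
  define K where "K = {x \<in> carrier G. U #> x \<in> M}"
  note K = subgroup_vimage_Mod[OF U M(1), folded K_def]
  interpret f: group_hom G "G Mod U" "\<lambda>x. U #> x" using U by (rule group_hom_Mod)
  have "K \<noteq> carrier G" using K(4) M(2) image_Mod by metis
  then have "nilp K" using nil K by blast
  moreover have "group_hom (G\<lparr>carrier := K\<rparr>) ((G Mod U)\<lparr>carrier := M\<rparr>) (\<lambda>x. U #> x)"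
    using subgroup_imp_group[OF K(1)] f.H.subgroup_imp_group[OF M(1)] f.hom_mult
    by (intro group_hom.intro group_hom_axioms.intro homI) (auto simp: K_def)
  ultimately show ?thesis
    using group_hom.nilpotent_surj_image[of "G\<lparr>carrier := K\<rparr>" "(G Mod U)\<lparr>carrier := M\<rparr>"] K(4) by simp
qed

text \<open>The preimage \<open>K\<close> of the complement or Sylow subgroup of the quotient is
  either already what is wanted, or a proper and hence nilpotent normal subgroup that contains it,
  or all of \<open>G\<close>. In the last case \<open>U\<close> itself serves, and the two
  alternatives may change places.\<close>

lemma q_nilpotent_or_q_closed_lift:
  assumes p: "Factorial_Ring.prime p" and U: "U \<lhd> G" "p_subgroup p U"
    and nil: "\<And>M. subgroup M G \<Longrightarrow> U \<subseteq> M \<Longrightarrow> M \<noteq> carrier G \<Longrightarrow> nilp M"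
    and q: "Factorial_Ring.prime q"
    and quot: "q_nilpotent (G Mod U) q \<or> q_closed (G Mod U) q"
  shows "q_nilpotent G q \<or> q_closed G q"
proof -
  interpret Q: finite_group "G Mod U" using U(1) by (rule finite_group_Mod)
  obtain j where j: "card U = p ^ j" using U by (auto simp: p_subgroup_def)
  have ord: "order G = order (G Mod U) * p ^ j" using order_Mod[OF U(1)] j by simp
  have mult: "multiplicity q (m * p ^ j) = multiplicity q m + (if q = p then j else 0)" if "m > 0" for m
  proof -
    have "multiplicity q (m * p ^ j) = multiplicity q m + multiplicity q (p ^ j)"
      using that p q by (intro prime_elem_multiplicity_mult_distrib) auto
    moreover have "multiplicity q (p ^ j) = (if q = p then j else 0)"
      using p q by (auto simp: multiplicity_same_power multiplicity_distinct_prime_power)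
    ultimately show ?thesis by simp
  qed
  from quot show ?thesis
  proof
    assume "q_nilpotent (G Mod U) q"
    then obtain N k where N: "N \<lhd> G Mod U" "coprime (card N) q" "card (rcosets\<^bsub>G Mod U\<^esub> N) = q ^ k"
      by (auto simp: q_nilpotent_def)
    define K where "K = {x \<in> carrier G. U #> x \<in> N}"
    note K = subgroup_vimage_Mod[OF U(1) normal_imp_subgroup[OF N(1)], folded K_def]
    have Kn: "K \<lhd> G" unfolding K_def using normal_vimage_Mod[OF U(1) N(1)] .
    have idx: "order G dvd card K * q ^ k"
      using Q.lagrange[OF normal_imp_subgroup[OF N(1)]] N(3) K(3) ord j by (simp add: ac_simps)
    show ?thesis
    proof (cases "q = p")
      case False
      then have "coprime (card K) q" using K(3) j N(2) p q primes_coprime by auto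
      then show ?thesis using q_nilpotentI[OF q Kn _ idx] by blast
    next
      case True
      show ?thesis
      proof (cases "K = carrier G")
        case True
        \<comment> \<open>Here the quotient has order prime to \<open>q\<close>, so \<open>U\<close>
          is a normal Sylow \<open>q\<close>-subgroup.\<close>
        then have ordG: "order G = card N * p ^ j" using K(3) j by (simp add: order_def)
        then have "card N > 0" using order_pos by (cases "card N") auto
        moreover have "\<not> q dvd card N" using N(2) q by (metis coprime_common_divisor dvd_refl not_prime_unit)
        ultimately have "multiplicity q (order G) = j"
          using mult[of "card N"] ordG \<open>q = p\<close> by (simp add: not_dvd_imp_multiplicity_0)
        then have "q_closed G q"
          using U j \<open>q = p\<close> by (auto simp: q_closed_def p_subgroup_def)
        then show ?thesis ..
      next
        case False
        then have "nilp K" using nil K by blast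
        then show ?thesis using nilp_normal_imp_q_nilpotent[OF q Kn _ idx] by blast
      qed
    qed
  next
    assume "q_closed (G Mod U) q"
    then obtain N where N: "N \<lhd> G Mod U" "card N = q ^ multiplicity q (order (G Mod U))"
      by (auto simp: q_closed_def)
    define K where "K = {x \<in> carrier G. U #> x \<in> N}"
    note K = subgroup_vimage_Mod[OF U(1) normal_imp_subgroup[OF N(1)], folded K_def]
    have Kn: "K \<lhd> G" unfolding K_def using normal_vimage_Mod[OF U(1) N(1)] .
    show ?thesis
    proof (cases "q = p")
      case True
      then have "card K = q ^ multiplicity q (order G)"
        using mult[OF Q.order_pos] K(3) N(2) j ord by (simp add: power_add)
      then show ?thesis using Kn K(1) by (auto simp: q_closed_def)
    next
      case False
      show ?thesis
      proof (cases "K = carrier G")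
        case True
        \<comment> \<open>Here the quotient is a \<open>q\<close>-group, so \<open>U\<close> is a
          normal \<open>q\<close>-complement.\<close>
        then have "order G dvd card U * q ^ multiplicity q (order (G Mod U))"
          using K(3) N(2) by (simp add: order_def mult.commute)
        moreover have "coprime (card U) q" using j p q False primes_coprime by auto
        ultimately show ?thesis using q_nilpotentI[OF q U(1)] by blast
      next
        case KG: False
        have nilK: "nilp K" using nil K KG by blast
        obtain S where S: "sylow_of q K S" using sylow_of_exists[OF q K(1)] by blast
        have "S \<lhd> G"
          using normal_sylow_of_normal[OF q Kn S nilp_sylow_normal[OF q nilK K(1) S]] .
        moreover have "multiplicity q (card K) = multiplicity q (order G)"
          using mult[OF Q.order_pos] mult[of "card N"] K(3) N(2) j ord q False
          by (simp add: multiplicity_same_power prime_gt_0_nat)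
        ultimately have "q_closed G q"
          using S by (auto simp: q_closed_def sylow_of_def)
        then show ?thesis ..
      qed
    qed
  qed
qed

text \<open>A normal \<open>p\<close>-subgroup \<open>N\<close> of the quotient has a normal
  \<open>p\<close>-subgroup of order \<open>card N * card U\<close> as preimage, so the choice of
  \<open>U\<close> with maximal order forces \<open>card N = 1\<close>.\<close>

lemma ex_max_normal_p_subgroup:
  assumes p: "Factorial_Ring.prime p"
  shows "\<exists>U. U \<lhd> G \<and> p_subgroup p U \<and>
    (\<forall>N. N \<lhd> G Mod U \<longrightarrow> group.p_subgroup (G Mod U) p N \<longrightarrow> N = {\<one>\<^bsub>G Mod U\<^esub>}) \<and>
    (\<forall>N. N \<lhd> G \<longrightarrow> p_subgroup p N \<longrightarrow> card N \<le> card U)"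
proof -
  have "p_subgroup p {\<one>}"
    unfolding p_subgroup_def using one_is_normal normal_imp_subgroup by (auto intro: exI[of _ 0])
  then obtain U where U: "U \<lhd> G" "p_subgroup p U"
    and max: "\<And>N. N \<lhd> G \<Longrightarrow> p_subgroup p N \<Longrightarrow> card N \<le> card U"
    using ex_max_card_normal[of "p_subgroup p"] by auto
  interpret Q: finite_group "G Mod U" using U(1) by (rule finite_group_Mod)
  have "N = {\<one>\<^bsub>G Mod U\<^esub>}" if N: "N \<lhd> G Mod U" "Q.p_subgroup p N" for N
  proof -
    have NQ: "subgroup N (G Mod U)" using N(1) by (rule normal_imp_subgroup)
    define K where "K = {x \<in> carrier G. U #> x \<in> N}"
    note K = subgroup_vimage_Mod[OF U(1) NQ, folded K_def]
    have Kn: "K \<lhd> G" unfolding K_def using normal_vimage_Mod[OF U(1) N(1)] .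
    obtain i j where "card U = p ^ i" "card N = p ^ j"
      using U N by (auto simp: p_subgroup_def Q.p_subgroup_def)
    then have "card K = p ^ (j + i)" using K(3) by (simp add: power_add)
    then have "p_subgroup p K" using K(1) by (auto simp: p_subgroup_def)
    then have "card N * card U \<le> card U" using max[OF Kn] K(3) by simp
    moreover have "card U > 0" "card N > 0"
      using card_subgroup_pos normal_imp_subgroup[OF U(1)] Q.card_subgroup_pos NQ by auto
    ultimately have "card N = 1" by simp
    then obtain a where "N = {a}" using card_1_singletonE by blast
    then show ?thesis using subgroup.one_closed[OF NQ] by auto
  qed
  then show ?thesis using U max by blast
qed

text \<open>With all proper subgroups nilpotent, \<open>q\<close> itself can play the role of
  \<open>p\<close> after dividing by the largest normal \<open>q\<close>-subgroup. The quotient is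
  then \<open>q\<close>-nilpotent, or its order is prime to \<open>q\<close>.\<close>

lemma proper_nilpotent_imp_q_nilpotent_or_q_closed:
  assumes nil: "\<And>M. subgroup M G \<Longrightarrow> M \<noteq> carrier G \<Longrightarrow> nilp M"
    and q: "Factorial_Ring.prime q"
  shows "q_nilpotent G q \<or> q_closed G q"
proof -
  obtain U where U: "U \<lhd> G" "p_subgroup q U"
    and no_normal: "\<And>N. N \<lhd> G Mod U \<Longrightarrow> group.p_subgroup (G Mod U) q N \<Longrightarrow> N = {\<one>\<^bsub>G Mod U\<^esub>}"
    using ex_max_normal_p_subgroup[OF q] by blast
  interpret Q: finite_group "G Mod U" using U(1) by (rule finite_group_Mod)
  have "q_nilpotent (G Mod U) q \<or> q_closed (G Mod U) q"
  proof (cases "q dvd order (G Mod U)")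
    case True
    then interpret L: nilpotent_p_locals "G Mod U" q
      using q no_normal nilp_Mod[OF U(1)] nil by unfold_locales auto
    show ?thesis using L.q_nilpotent_p by blast
  next
    case False
    \<comment> \<open>The trivial subgroup is the Sylow \<open>q\<close>-subgroup.\<close>
    then have "q_closed (G Mod U) q"
      using Q.one_is_normal normal_imp_subgroup[OF Q.one_is_normal] unfolding q_closed_def
      by (intro exI[of _ "{\<one>\<^bsub>G Mod U\<^esub>}"]) (simp add: not_dvd_imp_multiplicity_0)
    then show ?thesis ..
  qed
  then show ?thesis
    using q_nilpotent_or_q_closed_lift[OF q U] nil q by blast
qed

section \<open>From maximal subgroups to the theorem\<close>

lemma ex_maximal_subgroup:
  assumes M: "subgroup M G" "M \<noteq> carrier G"
  shows "\<exists>H. maximal_subgroup H G \<and> M \<subseteq> H"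
proof -
  let ?R = "\<lambda>H. subgroup H G \<and> M \<subseteq> H \<and> H \<noteq> carrier G"
  have "\<exists>H. ?R H \<and> (\<forall>H'. ?R H' \<longrightarrow> card H' \<le> card H)"
  proof (rule ex_has_greatest_nat[where k = M and b = "Suc (order G)"])
    show "\<forall>H. ?R H \<longrightarrow> card H < Suc (order G)"
      by (auto simp: less_Suc_eq_le order_pos intro: dvd_imp_le card_subgroup_dvd_order)
  qed (use M in auto)
  then obtain H where H: "?R H" and max: "\<And>H'. ?R H' \<Longrightarrow> card H' \<le> card H" by blast
  have "H' = H \<or> H' = carrier G" if H': "subgroup H' G" "H \<subseteq> H'" for H'
  proof (rule ccontr)
    assume "\<not> ?thesis"
    then have "card H' \<le> card H" "H' \<noteq> H" using max[of H'] H H' by auto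
    then show False using card_seteq[OF finite_subgroup[OF H'(1)] H'(2)] by simp
  qed
  then show ?thesis using H unfolding maximal_subgroup_def by blast
qed

end

theorem theorem1p9:
  fixes G (structure) and p :: nat
  assumes "group G" and "finite (carrier G)"
    and "Factorial_Ring.prime p" and "p dvd order G"
    and "\<forall>M. maximal_subgroup M G \<longrightarrow>
            nilpotent_group (G\<lparr>carrier := M\<rparr>) \<or> \<not> p dvd card M"
  shows "\<forall>q :: nat. Factorial_Ring.prime q \<and> q dvd order G \<longrightarrow> q_nilpotent G q \<or> q_closed G q"
proof (intro allI impI)
  fix q :: nat
  assume q: "Factorial_Ring.prime q \<and> q dvd order G"
  interpret finite_group G
    using assms(1,2) by (simp add: finite_group_def finite_group_axioms_def)
  \<comment> \<open>A maximal subgroup above \<open>M\<close> also has order divisible by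
    \<open>p\<close>, and nilpotency passes down to \<open>M\<close>.\<close>
  have nil: "nilp M" if M: "subgroup M G" "M \<noteq> carrier G" "p dvd card M" for M
  proof -
    obtain H where H: "maximal_subgroup H G" "M \<subseteq> H"
      using ex_maximal_subgroup[OF M(1,2)] by blast
    have HG: "subgroup H G" using H(1) by (simp add: maximal_subgroup_def)
    have "p dvd card H"
      using M(3) card_subgroup_dvd[OF M(1) HG H(2)] by (rule dvd_trans)
    then have "nilp H" using assms(5) H(1) by blast
    then show ?thesis using HG M(1) H(2) by (rule nilp_subset)
  qed
  obtain U where U: "U \<lhd> G" "p_subgroup p U"
    and max: "\<And>N. N \<lhd> G \<Longrightarrow> p_subgroup p N \<Longrightarrow> card N \<le> card U"
    using ex_max_normal_p_subgroup[OF assms(3)] by blast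
  have XG: "subgroup U G" using U(1) by (rule normal_imp_subgroup)
  show "q_nilpotent G q \<or> q_closed G q"
  proof (cases "card U = 1")
    case True
    have "N = {\<one>}" if "N \<lhd> G" "p_subgroup p N" for N
    proof -
      have NG: "subgroup N G" using that(1) by (rule normal_imp_subgroup)
      have "card N = 1"
        using max[OF that] True card_subgroup_pos[OF NG] by simp
      then obtain a where "N = {a}" using card_1_singletonE by blast
      then show ?thesis using subgroup.one_closed[OF NG] by auto
    qed
    then interpret nilpotent_p_locals G p
      using assms(3,4) nil by unfold_locales auto
    show ?thesis using q_nilpotent_p q_closed_q q by (cases "q = p") auto
  next
    case False
    \<comment> \<open>Every subgroup containing \<open>U\<close> now has order divisible by
      \<open>p\<close>, so all proper ones are nilpotent, and with them all proper subgroups of the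
      quotient.\<close>
    have "p dvd card U"
      using U(2) False by (auto simp: p_subgroup_def gr0_conv_Suc)
    then have nilX: "nilp M" if "subgroup M G" "U \<subseteq> M" "M \<noteq> carrier G" for M
      using nil[OF that(1,3)] card_subgroup_dvd[OF XG that(1,2)] by (meson dvd_trans)
    interpret Q: finite_group "G Mod U" using U(1) by (rule finite_group_Mod)
    have "q_nilpotent (G Mod U) q \<or> q_closed (G Mod U) q"
      using q nilp_Mod[OF U(1) nilX] by (intro Q.proper_nilpotent_imp_q_nilpotent_or_q_closed) auto
    then show ?thesis
      using q_nilpotent_or_q_closed_lift[OF assms(3) U nilX] q by blast
  qed
qed

end
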